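(* Let $\mathcal T$ be a physical theory and let $\widetilde V_{\mathcal T}$ be the vector space generated by connected $1PI$ specified Feynman graphs of $\mathcal T$. Equipped with the insertion product $\triangleright$, the space $\widetilde V_{\mathcal T}$ is a (left) pre-Lie algebra; that is, for all $x,y,z\in \widetilde V_{\mathcal T}$, $$(x \triangleright y) \triangleright z - x \triangleright (y \triangleright z) = (y \triangleright x) \triangleright z - y \triangleright (x \triangleright z).$$
   Context: **Feynman graphs.** A graph $\Gamma$ is given by a finite set $\mathcal V(\Gamma)$ of vertices, a finite set $\mathcal E(\Gamma)$ of half-edges, a map $\partial:\mathcal E(\Gamma)\to\mathcal V(\Gamma)$ and an involution $\sigma_\Gamma:\mathcal E(\Gamma)\to\mathcal E(\Gamma)$. Half-edges are partitioned into types and $\sigma_\Gamma$ respects types. Fixed points of $\sigma_\Gamma$ are the external edges; pairs $\{e,\sigma_\Gamma(e)\}$ with $e\ne\sigma_\Gamma(e)$ are the internal edges; $st(v)=\partial^{-1}(v)$. Graphs are considered up to isomorphism. $\pi_0(\Gamma)$ is the set of connected components. A $1PI$ graph is a connected graph which remains connected when any one internal edge is cut (replaced by two external edges); a graph is locally $1PI$ if all its connected components are $1PI$. The residue $\mathrm{res}\,\Gamma$ is obtained from $\Gamma$ by shrinking each connected component to a point (retaining its external edges). **Theory.** A theory $\mathcal T$ prescribes a set $\mathcal E(\mathcal T)$ of half-edge types and a set $\mathcal V(\mathcal T)$ of vertex types. The types of the half-edges in $st(v)$ need not determine the type of $v$; vertex types sharing the same collection of half-edge types are distinguished by an integer index (for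 example, $\varphi^3$ has one half-edge type, a trivalent vertex type, and two bivalent vertex types, indexed $0$ and $1$). **Specified graphs.** A specified graph of $\mathcal T$ is a couple $\bar\Gamma=(\Gamma,\underline i)$ where $\Gamma$ is a locally $1PI$ superficially divergent graph (the residue of each component is a vertex of $\mathcal T$) with half-edges and vertices of the types prescribed by $\mathcal T$, and $\underline i:\pi_0(\Gamma)\to\mathbb N$ is such that $\underline i(\gamma)$ is one of the indices allowed by the possible types of the vertex obtained by contracting the component $\gamma$ to a point. Thus, for $\Gamma$ connected, $\underline i$ specifies the vertex type of $\mathrm{res}\,\bar\Gamma$. $\widetilde V_{\mathcal T}$ is the vector space (over a field $k$) generated by the connected ($1PI$) specified graphs. **Insertion.** For connected specified graphs $\bar\Gamma_1=(\Gamma_1,\underline i)$, $\bar\Gamma_2=(\Gamma_2,\underline j)$ and $v\in\mathcal V(\Gamma_2)$, put $$\bar\Gamma_1\triangleright_v\bar\Gamma_2=\begin{cases}(\Gamma_1\cup_v\Gamma_2,\underline j)&\text{if } v=\mathrm{res}\,\bar\Gamma_1 \text{ (the type of } v \text{ is the type of } \mathrm{res}\,\bar\Gamma_1),\\ 0&\text{otherwise,}\end{cases}$$ where $\Gamma_1\cup_v\Gamma_2$ is the sum of all possible graphs obtained by replacing the vertex $v$ by $\Gamma_1$ in $\Gamma_2$, i.e. the sum over all type-preserving bijections between the external edges of $\Gamma_1$ and $st(v)$ (so counted with multiplicity). Then $$\bar\Gamma_1\triangleright\bar\Gamma_2=\sum_{v\in\mathcal V(\Gamma_2)}\bar\Gamma_1\triangleright_v\bar\Gamma_2,$$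 extended bilinearly to $\widetilde V_{\mathcal T}$. *)

theory Defs
  imports Complex_Main "HOL-Library.Multiset" "HOL-Library.FuncSet" "HOL-Library.Poly_Mapping"
begin

section \<open>Graphs\<close>

text \<open>
  The map \<open>vindex\<close> carries the part of the type of a vertex that is not determined by the
  types of the half-edges attached to it; see \<open>vertex_type\<close> below.
\<close>

record ('v, 'h, 't) feynman_graph =
  verts :: "'v set"
  halves :: "'h set"
  bd :: "'h \<Rightarrow> 'v"
  sigma :: "'h \<Rightarrow> 'h"
  htype :: "'h \<Rightarrow> 't"
  vindex :: "'v \<Rightarrow> nat"

definition feynman_graph :: "('v, 'h, 't) feynman_graph \<Rightarrow> bool" where
  "feynman_graph G \<longleftrightarrow>
     finite (verts G) \<and> finite (halves G) \<and>
     bd G \<in> halves G \<rightarrow> verts G \<and>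
     sigma G \<in> halves G \<rightarrow> halves G \<and>
     (\<forall>e\<in>halves G. sigma G (sigma G e) = e) \<and>
     (\<forall>e\<in>halves G. htype G (sigma G e) = htype G e)"

definition star :: "('v, 'h, 't) feynman_graph \<Rightarrow> 'v \<Rightarrow> 'h set" where
  "star G v = {e \<in> halves G. bd G e = v}"

definition externals :: "('v, 'h, 't) feynman_graph \<Rightarrow> 'h set" where
  "externals G = {e \<in> halves G. sigma G e = e}"

text \<open>The half-edges belonging to internal edges.\<close>

definition internals :: "('v, 'h, 't) feynman_graph \<Rightarrow> 'h set" where
  "internals G = {e \<in> halves G. sigma G e \<noteq> e}"

text \<open>
  A vertex type is a collection (multiset) of half-edge types together with an index that
  distinguishes the vertex types sharing this collection.
\<close>

type_synonym 't vertex_type = "'t multiset \<times> nat"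

definition vertex_type :: "('v, 'h, 't) feynman_graph \<Rightarrow> 'v \<Rightarrow> 't vertex_type" where
  "vertex_type G v = (image_mset (htype G) (mset_set (star G v)), vindex G v)"


subsection \<open>Connectedness and one-particle irreducibility\<close>

definition connection :: "('v, 'h, 't) feynman_graph \<Rightarrow> ('v \<times> 'v) set" where
  "connection G =
     {(u, w). u \<in> verts G \<and> w \<in> verts G \<and>
              (u, w) \<in> ((\<lambda>e. (bd G e, bd G (sigma G e))) ` halves G)\<^sup>*}"

text \<open>A connected component is represented by its set of vertices.\<close>

definition components :: "('v, 'h, 't) feynman_graph \<Rightarrow> 'v set set" where
  "components G = verts G // connection G"

text \<open>In particular the empty graph is not connected.\<close>

definition connected_graph :: "('v, 'h, 't) feynman_graph \<Rightarrow> bool" where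
  "connected_graph G \<longleftrightarrow> card (components G) = 1"

definition component_graph ::
  "('v, 'h, 't) feynman_graph \<Rightarrow> 'v set \<Rightarrow> ('v, 'h, 't) feynman_graph" where
  "component_graph G C = G\<lparr>verts := C, halves := {e \<in> halves G. bd G e \<in> C}\<rparr>"

text \<open>Cutting the internal edge formed by \<open>e\<close> and \<open>sigma G e\<close> turns both into external edges.\<close>

definition cut :: "('v, 'h, 't) feynman_graph \<Rightarrow> 'h \<Rightarrow> ('v, 'h, 't) feynman_graph" where
  "cut G e = G\<lparr>sigma := (sigma G)(e := e, sigma G e := sigma G e)\<rparr>"

definition one_PI :: "('v, 'h, 't) feynman_graph \<Rightarrow> bool" where
  "one_PI G \<longleftrightarrow> connected_graph G \<and> (\<forall>e\<in>internals G. connected_graph (cut G e))"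

definition locally_one_PI :: "('v, 'h, 't) feynman_graph \<Rightarrow> bool" where
  "locally_one_PI G \<longleftrightarrow> (\<forall>C\<in>components G. one_PI (component_graph G C))"


section \<open>Theories and specified graphs\<close>

record 't theory_types =
  half_edge_types :: "'t set"
  vertex_types :: "'t vertex_type set"

definition physical_theory :: "'t theory_types \<Rightarrow> bool" where
  "physical_theory T \<longleftrightarrow> (\<forall>(M, k)\<in>vertex_types T. set_mset M \<subseteq> half_edge_types T)"

definition graph_of_theory :: "'t theory_types \<Rightarrow> ('v, 'h, 't) feynman_graph \<Rightarrow> bool" where
  "graph_of_theory T G \<longleftrightarrow>
     feynman_graph G \<and>
     (\<forall>e\<in>halves G. htype G e \<in> half_edge_types T) \<and>
     (\<forall>v\<in>verts G. vertex_type G v \<in> vertex_types T)"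

text \<open>
  A graph together with an index for each of its connected components. The index function is
  total; only its values on \<open>components\<close> are relevant.
\<close>

type_synonym ('v, 'h, 't) indexed_graph = "('v, 'h, 't) feynman_graph \<times> ('v set \<Rightarrow> nat)"

text \<open>
  The residue: every component is shrunk to a point, which retains the external edges of the
  component and acquires its index.
\<close>

fun residue :: "('v, 'h, 't) indexed_graph \<Rightarrow> ('v set, 'h, 't) feynman_graph" where
  "residue (G, i) =
     \<lparr>verts = components G,
      halves = externals G,
      bd = (\<lambda>e. connection G `` {bd G e}),
      sigma = (\<lambda>e. e),
      htype = htype G,
      vindex = i\<rparr>"

definition superficially_divergent ::
  "'t theory_types \<Rightarrow> ('v, 'h, 't) feynman_graph \<Rightarrow> bool" where
  "superficially_divergent T G \<longleftrightarrow>
     (\<forall>C\<in>components G. \<exists>k. vertex_type (residue (G, \<lambda>_. k)) C \<in> vertex_types T)"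

fun specified_graph :: "'t theory_types \<Rightarrow> ('v, 'h, 't) indexed_graph \<Rightarrow> bool" where
  "specified_graph T (G, i) \<longleftrightarrow>
     graph_of_theory T G \<and> locally_one_PI G \<and> superficially_divergent T G \<and>
     (\<forall>C\<in>components G. vertex_type (residue (G, i)) C \<in> vertex_types T)"

definition connected_specified_graph ::
  "'t theory_types \<Rightarrow> ('v, 'h, 't) indexed_graph \<Rightarrow> bool" where
  "connected_specified_graph T X \<longleftrightarrow> specified_graph T X \<and> connected_graph (fst X)"

text \<open>The type of the only vertex of the residue of a connected graph.\<close>

definition residue_type :: "('v, 'h, 't) indexed_graph \<Rightarrow> 't vertex_type" where
  "residue_type X = vertex_type (residue X) (the_elem (components (fst X)))"


subsection \<open>Isomorphism classes\<close>

definition graph_isomorphism ::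
  "('v \<Rightarrow> 'w) \<Rightarrow> ('h \<Rightarrow> 'g) \<Rightarrow> ('v, 'h, 't) feynman_graph \<Rightarrow> ('w, 'g, 't) feynman_graph \<Rightarrow> bool"
  where
  "graph_isomorphism f g G H \<longleftrightarrow>
     bij_betw f (verts G) (verts H) \<and> bij_betw g (halves G) (halves H) \<and>
     (\<forall>e\<in>halves G. bd H (g e) = f (bd G e) \<and> sigma H (g e) = g (sigma G e) \<and>
                     htype H (g e) = htype G e) \<and>
     (\<forall>v\<in>verts G. vindex H (f v) = vindex G v)"

fun isomorphic :: "('v, 'h, 't) indexed_graph \<Rightarrow> ('w, 'g, 't) indexed_graph \<Rightarrow> bool" where
  "isomorphic (G, i) (H, j) \<longleftrightarrow>
     (\<exists>f g. graph_isomorphism f g G H \<and> (\<forall>C\<in>components G. j (f ` C) = i C))"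

text \<open>
  Every finite graph is isomorphic to one whose vertices and half-edges are natural numbers,
  so isomorphism classes of graphs over arbitrary types may be formed inside one type.
\<close>

type_synonym 't graph_class = "(nat, nat, 't) indexed_graph set"

definition iso_class :: "('v, 'h, 't) indexed_graph \<Rightarrow> 't graph_class" where
  "iso_class X = {Y. feynman_graph (fst Y) \<and> isomorphic Y X}"


section \<open>The space of specified graphs\<close>

definition generators :: "'t theory_types \<Rightarrow> 't graph_class set" where
  "generators T =
     {iso_class X |X :: (nat, nat, 't) indexed_graph. connected_specified_graph T X}"

definition graph_space :: "'t theory_types \<Rightarrow> ('t graph_class \<Rightarrow>\<^sub>0 'k::field) set" where
  "graph_space T = {x. Poly_Mapping.keys x \<subseteq> generators T}"

definition scale_space :: "'k::field \<Rightarrow> ('a \<Rightarrow>\<^sub>0 'k) \<Rightarrow> ('a \<Rightarrow>\<^sub>0 'k)" where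
  "scale_space c x = Poly_Mapping.map ((*) c) x"

definition gen :: "('v, 'h, 't) indexed_graph \<Rightarrow> ('t graph_class \<Rightarrow>\<^sub>0 'k::field)" where
  "gen X = Poly_Mapping.single (iso_class X) 1"


section \<open>Insertion\<close>

definition gluings ::
  "('v, 'h, 't) feynman_graph \<Rightarrow> ('w, 'g, 't) feynman_graph \<Rightarrow> 'w \<Rightarrow> ('h \<Rightarrow> 'g) set" where
  "gluings G1 G2 v =
     {b \<in> extensional (externals G1).
        bij_betw b (externals G1) (star G2 v) \<and>
        (\<forall>e\<in>externals G1. htype G2 (b e) = htype G1 e)}"

text \<open>
  The vertex \<open>v\<close> of \<open>G2\<close> is replaced by \<open>G1\<close>. Each external edge \<open>e\<close> of \<open>G1\<close> is identified with
  the half-edge \<open>b e\<close> of \<open>G2\<close>, which thereby becomes attached to \<open>bd G1 e\<close>.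
\<close>

definition replace_vertex ::
  "('h \<Rightarrow> 'g) \<Rightarrow> ('v, 'h, 't) feynman_graph \<Rightarrow> 'w \<Rightarrow> ('w, 'g, 't) feynman_graph \<Rightarrow>
   ('v + 'w, 'h + 'g, 't) feynman_graph" where
  "replace_vertex b G1 v G2 =
     \<lparr>verts = Inl ` verts G1 \<union> Inr ` (verts G2 - {v}),
      halves = Inl ` internals G1 \<union> Inr ` halves G2,
      bd = case_sum
             (\<lambda>e. Inl (bd G1 e))
             (\<lambda>h. if bd G2 h = v then Inl (bd G1 (the_inv_into (externals G1) b h))
                  else Inr (bd G2 h)),
      sigma = map_sum (sigma G1) (sigma G2),
      htype = case_sum (htype G1) (htype G2),
      vindex = case_sum (vindex G1) (vindex G2)\<rparr>"

text \<open>
  The index of the second factor is transported along the map that contracts the inserted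
  graph back to \<open>v\<close>.
\<close>

fun insert_along ::
  "('h \<Rightarrow> 'g) \<Rightarrow> ('v, 'h, 't) indexed_graph \<Rightarrow> 'w \<Rightarrow> ('w, 'g, 't) indexed_graph \<Rightarrow>
   ('v + 'w, 'h + 'g, 't) indexed_graph" where
  "insert_along b (G1, i) v (G2, j) =
     (replace_vertex b G1 v G2, \<lambda>C. j (case_sum (\<lambda>_. v) (\<lambda>w. w) ` C))"

definition insert_at ::
  "('v, 'h, 't) indexed_graph \<Rightarrow> 'w \<Rightarrow> ('w, 'g, 't) indexed_graph \<Rightarrow>
   ('t graph_class \<Rightarrow>\<^sub>0 'k::field)" where
  "insert_at X v Y =
     (if vertex_type (fst Y) v = residue_type X
      then \<Sum>b\<in>gluings (fst X) (fst Y) v. gen (insert_along b X v Y)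
      else 0)"

definition insert_graph ::
  "('v, 'h, 't) indexed_graph \<Rightarrow> ('w, 'g, 't) indexed_graph \<Rightarrow>
   ('t graph_class \<Rightarrow>\<^sub>0 'k::field)" where
  "insert_graph X Y = (\<Sum>v\<in>verts (fst Y). insert_at X v Y)"

text \<open>The bilinear extension, evaluated on generators through chosen representatives.\<close>

definition insertion ::
  "('t graph_class \<Rightarrow>\<^sub>0 'k::field) \<Rightarrow> ('t graph_class \<Rightarrow>\<^sub>0 'k) \<Rightarrow> ('t graph_class \<Rightarrow>\<^sub>0 'k)"
  (infixl \<open>\<rhd>\<close> 70) where
  "x \<rhd> y =
     (\<Sum>A\<in>Poly_Mapping.keys x. \<Sum>B\<in>Poly_Mapping.keys y.
        scale_space (Poly_Mapping.lookup x A * Poly_Mapping.lookup y B)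
          (insert_graph (SOME X. X \<in> A) (SOME Y. Y \<in> B)))"


section \<open>Left pre-Lie algebras\<close>

locale left_pre_lie_algebra = vector_space scale
  for scale :: "'k::field \<Rightarrow> 'a::ab_group_add \<Rightarrow> 'a" +
  fixes V :: "'a set" and prod :: "'a \<Rightarrow> 'a \<Rightarrow> 'a"
  assumes subspace_carrier: "subspace V"
    and prod_closed: "x \<in> V \<Longrightarrow> y \<in> V \<Longrightarrow> prod x y \<in> V"
    and prod_add_left: "x \<in> V \<Longrightarrow> y \<in> V \<Longrightarrow> z \<in> V \<Longrightarrow> prod (x + y) z = prod x z + prod y z"
    and prod_add_right: "x \<in> V \<Longrightarrow> y \<in> V \<Longrightarrow> z \<in> V \<Longrightarrow> prod x (y + z) = prod x y + prod x z"
    and prod_scale_left: "x \<in> V \<Longrightarrow> y \<in> V \<Longrightarrow> prod (scale c x) y = scale c (prod x y)"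
    and prod_scale_right: "x \<in> V \<Longrightarrow> y \<in> V \<Longrightarrow> prod x (scale c y) = scale c (prod x y)"
    and pre_lie: "x \<in> V \<Longrightarrow> y \<in> V \<Longrightarrow> z \<in> V \<Longrightarrow>
          prod (prod x y) z - prod x (prod y z) = prod (prod y x) z - prod y (prod x z)"

end

theory Submission
  imports Defs
begin

text \<open>
  Insert \<open>Y\<close> into \<open>Z\<close> and then \<open>X\<close> into the result. The vertices at which \<open>X\<close> can be placed are
  those of \<open>Y\<close> and those of \<open>Z\<close> other than the replaced one. The placements of the first kind
  are the terms of \<open>(X \<rhd> Y) \<rhd> Z\<close>: a vertex of \<open>Y\<close> keeps its type inside the composite, and the
  external half-edges of the composite of \<open>X\<close> and \<open>Y\<close> are those of \<open>Y\<close>, so both orders of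
  insertion use the same pairs of gluings (\<open>insert_at_nested\<close>, \<open>insert_at_of_composite\<close>) and
  give isomorphic graphs (\<open>graph_isomorphism_insert_assoc\<close>). Hence the associator
  \<open>(X \<rhd> Y) \<rhd> Z - X \<rhd> (Y \<rhd> Z)\<close> is minus the sum over the placements of the second kind, in
  which \<open>X\<close> and \<open>Y\<close> replace two distinct vertices of \<open>Z\<close> (\<open>insert_graph_insert_graph\<close>). Insertions
  at distinct vertices do not interfere, so this sum is symmetric in \<open>X\<close> and \<open>Y\<close>
  (\<open>insert_pair_commute\<close>), and that symmetry is the left pre-Lie identity.

  Two further points make this an argument about the space spanned by isomorphism classes. The
  product of two classes is computed from chosen representatives over the natural numbers,
  while the graphs above live over nested sum types. Since \<open>insert_graph\<close> is invariant under
  isomorphisms between graphs over arbitrary types (\<open>insert_graph_isomorphic_left\<close>,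
  \<open>insert_graph_isomorphic_right\<close>), the product of two generators may be computed from whatever
  representatives are at hand (\<open>gen_insertion\<close>). And the space is closed under the product,
  because replacing a vertex of a connected or 1PI graph by another such graph again gives a
  connected or 1PI graph (\<open>connected_graph_by_contraction\<close>), while vertex types and the residue
  type are unchanged.
\<close>

section \<open>Connected graphs\<close>

definition connected_feynman_graph :: "('v, 'h, 't) feynman_graph \<Rightarrow> bool" where
  "connected_feynman_graph G \<longleftrightarrow> feynman_graph G \<and> connected_graph G"

lemma bd_in_verts: "feynman_graph G \<Longrightarrow> e \<in> halves G \<Longrightarrow> bd G e \<in> verts G"
  by (auto simp: feynman_graph_def)

lemma sigma_in_halves: "feynman_graph G \<Longrightarrow> e \<in> halves G \<Longrightarrow> sigma G e \<in> halves G"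
  by (auto simp: feynman_graph_def)

lemma sigma_sigma: "feynman_graph G \<Longrightarrow> e \<in> halves G \<Longrightarrow> sigma G (sigma G e) = e"
  by (auto simp: feynman_graph_def)

lemma htype_sigma: "feynman_graph G \<Longrightarrow> e \<in> halves G \<Longrightarrow> htype G (sigma G e) = htype G e"
  by (auto simp: feynman_graph_def)

lemma sigma_in_internals: "feynman_graph G \<Longrightarrow> e \<in> internals G \<Longrightarrow> sigma G e \<in> internals G"
  by (auto simp: internals_def sigma_sigma sigma_in_halves)

lemma externals_in_halves: "e \<in> externals G \<Longrightarrow> e \<in> halves G"
  by (simp add: externals_def)

lemma internals_in_halves: "e \<in> internals G \<Longrightarrow> e \<in> halves G"
  by (simp add: internals_def)

lemma connection_closed:
  assumes "feynman_graph G" "e \<in> halves G" "bd G e \<in> connection G `` {u}"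
  shows "bd G (sigma G e) \<in> connection G `` {u}"
proof -
  have "(bd G e, bd G (sigma G e)) \<in> (\<lambda>e. (bd G e, bd G (sigma G e))) ` halves G"
    using assms(2) by auto
  then show ?thesis
    using assms(3) bd_in_verts[OF assms(1) sigma_in_halves[OF assms(1,2)]]
    by (auto simp: connection_def intro: rtrancl_into_rtrancl)
qed

text \<open>
  Connectedness by cut-sets: no proper nonempty set of vertices is closed under following edges.
  In this form connectedness passes through relabelings and contractions by taking preimages
  of sets of vertices, without lifting paths.
\<close>

lemma connected_graph_iff:
  assumes "feynman_graph G"
  shows "connected_graph G \<longleftrightarrow> verts G \<noteq> {} \<and>
    (\<forall>S\<subseteq>verts G. S \<noteq> {} \<longrightarrow> (\<forall>e\<in>halves G. bd G e \<in> S \<longrightarrow> bd G (sigma G e) \<in> S) \<longrightarrow> S = verts G)"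
    (is "?L \<longleftrightarrow> ?R")
proof
  let ?E = "(\<lambda>e. (bd G e, bd G (sigma G e))) ` halves G"
  assume ?L
  then obtain C where C: "components G = {C}"
    unfolding connected_graph_def by (auto simp: card_1_singleton_iff)
  have ne: "verts G \<noteq> {}" using C by (auto simp: components_def)
  have path: "(u, w) \<in> ?E\<^sup>*" if "u \<in> verts G" "w \<in> verts G" for u w
  proof -
    have "connection G `` {u} = C" "connection G `` {w} = C"
      using C that unfolding components_def by (auto simp: quotient_def)
    moreover have "w \<in> connection G `` {w}" using that by (auto simp: connection_def)
    ultimately have "(u, w) \<in> connection G" by auto
    then show ?thesis by (simp add: connection_def)
  qed
  have "S = verts G" if S: "S \<subseteq> verts G" "S \<noteq> {}"
    and cl: "\<forall>e\<in>halves G. bd G e \<in> S \<longrightarrow> bd G (sigma G e) \<in> S" for S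
  proof -
    obtain u where u: "u \<in> S" using S by auto
    have "w \<in> S" if "(u, w) \<in> ?E\<^sup>*" for w
      using that by (induction rule: rtrancl_induct) (use u cl in auto)
    then show ?thesis using path u S by blast
  qed
  with ne show ?R by blast
next
  assume R: ?R
  have "connection G `` {u} = verts G" if u: "u \<in> verts G" for u
  proof -
    have "connection G `` {u} \<subseteq> verts G" "u \<in> connection G `` {u}"
      using u by (auto simp: connection_def)
    then show ?thesis using R connection_closed[OF assms] by blast
  qed
  then have "components G = {verts G}"
    using R unfolding components_def quotient_def by auto
  then show ?L by (simp add: connected_graph_def)
qed

lemma connected_graph_nonempty: "feynman_graph G \<Longrightarrow> connected_graph G \<Longrightarrow> verts G \<noteq> {}"
  by (simp add: connected_graph_iff)

lemma connected_graph_closed_set: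
  assumes "feynman_graph G" "connected_graph G" "S \<subseteq> verts G" "S \<noteq> {}"
    and "\<And>e. e \<in> halves G \<Longrightarrow> bd G e \<in> S \<Longrightarrow> bd G (sigma G e) \<in> S"
  shows "S = verts G"
  using assms by (simp add: connected_graph_iff)

lemma connected_graphI:
  assumes "feynman_graph G" "verts G \<noteq> {}"
    and "\<And>S. S \<subseteq> verts G \<Longrightarrow> S \<noteq> {} \<Longrightarrow>
      (\<And>e. e \<in> halves G \<Longrightarrow> bd G e \<in> S \<Longrightarrow> bd G (sigma G e) \<in> S) \<Longrightarrow> S = verts G"
  shows "connected_graph G"
  using assms by (simp add: connected_graph_iff)

lemma connection_connected:
  assumes "feynman_graph G" "connected_graph G" "u \<in> verts G"
  shows "connection G `` {u} = verts G"
proof (rule connected_graph_closed_set[OF assms(1,2)])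
  show "connection G `` {u} \<subseteq> verts G" "connection G `` {u} \<noteq> {}"
    using assms(3) by (auto simp: connection_def)
qed (rule connection_closed[OF assms(1)])

lemma components_connected:
  assumes "feynman_graph G" "connected_graph G"
  shows "components G = {verts G}"
  using connection_connected[OF assms] connected_graph_nonempty[OF assms]
  unfolding components_def quotient_def by auto

lemma residue_type_connected:
  assumes "connected_feynman_graph (fst X)"
  shows "residue_type X =
    (image_mset (htype (fst X)) (mset_set (externals (fst X))), snd X (verts (fst X)))"
proof -
  obtain G i where X: "X = (G, i)" by (cases X)
  have G: "feynman_graph G" "connected_graph G"
    using assms by (auto simp: X connected_feynman_graph_def)
  have "star (residue (G, i)) (verts G) = externals G"
    using connection_connected[OF G bd_in_verts[OF G(1)]]
    by (auto simp: star_def externals_def)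
  then show ?thesis
    by (simp add: residue_type_def X components_connected[OF G] vertex_type_def)
qed

text \<open>
  For a connected graph the conditions on components collapse to conditions on the graph
  itself, and superficial divergence follows from the condition on the chosen index.
\<close>

lemma connected_specified_graph_iff:
  "connected_specified_graph T X \<longleftrightarrow>
     graph_of_theory T (fst X) \<and> one_PI (fst X) \<and> residue_type X \<in> vertex_types T"
proof -
  obtain G i where X: "X = (G, i)" by (cases X)
  show ?thesis
  proof (cases "feynman_graph G \<and> connected_graph G")
    case True
    then have "{e \<in> halves G. bd G e \<in> verts G} = halves G"
      by (auto simp: bd_in_verts)
    then have "component_graph G (verts G) = G"
      by (simp add: component_graph_def)
    moreover have "vertex_type (residue (G, i)) (verts G)
        = vertex_type (residue (G, \<lambda>_. i (verts G))) (verts G)"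
      by (simp add: vertex_type_def star_def)
    ultimately show ?thesis
      using True
      by (auto simp: X connected_specified_graph_def components_connected locally_one_PI_def
          superficially_divergent_def residue_type_def simp del: residue.simps)
  next
    case False
    then show ?thesis
      by (auto simp: X connected_specified_graph_def graph_of_theory_def one_PI_def)
  qed
qed

lemma connected_specified_graph_connected:
  "connected_specified_graph T X \<Longrightarrow> connected_feynman_graph (fst X)"
  by (simp add: connected_specified_graph_iff connected_feynman_graph_def graph_of_theory_def
      one_PI_def)

lemma feynman_graph_cut:
  "feynman_graph G \<Longrightarrow> e \<in> halves G \<Longrightarrow> feynman_graph (cut G e)"
  unfolding feynman_graph_def cut_def by (auto simp: Pi_iff) (metis)

section \<open>Isomorphisms\<close>

lemma graph_isomorphism_inverse:
  assumes "graph_isomorphism f g G H" "feynman_graph G"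
  shows "graph_isomorphism (inv_into (verts G) f) (inv_into (halves G) g) H G"
proof -
  have f: "bij_betw f (verts G) (verts H)" and g: "bij_betw g (halves G) (halves H)"
    and e: "\<And>e. e \<in> halves G \<Longrightarrow> bd H (g e) = f (bd G e) \<and> sigma H (g e) = g (sigma G e) \<and>
                     htype H (g e) = htype G e"
    and v: "\<And>v. v \<in> verts G \<Longrightarrow> vindex H (f v) = vindex G v"
    using assms by (auto simp: graph_isomorphism_def)
  have f': "inj_on f (verts G)" "f ` verts G = verts H"
    and g': "inj_on g (halves G)" "g ` halves G = halves H"
    using f g by (auto simp: bij_betw_def)
  have "bij_betw (inv_into (verts G) f) (verts H) (verts G)"
    "bij_betw (inv_into (halves G) g) (halves H) (halves G)"
    using f g by (simp_all add: bij_betw_inv_into)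
  moreover have "bd G (inv_into (halves G) g e') = inv_into (verts G) f (bd H e') \<and>
      sigma G (inv_into (halves G) g e') = inv_into (halves G) g (sigma H e') \<and>
      htype G (inv_into (halves G) g e') = htype H e'" if "e' \<in> halves H" for e'
  proof -
    have "e' \<in> g ` halves G" using that g'(2) by simp
    then obtain h where h: "h \<in> halves G" "e' = g h" by auto
    show ?thesis
      using e[OF h(1)] f'(1) g'(1) bd_in_verts[OF assms(2) h(1)] sigma_in_halves[OF assms(2) h(1)] h
      by simp
  qed
  moreover have "vindex G (inv_into (verts G) f v') = vindex H v'" if "v' \<in> verts H" for v'
  proof -
    have "v' \<in> f ` verts G" using that f'(2) by simp
    then obtain u where "u \<in> verts G" "v' = f u" by auto
    then show ?thesis using v f'(1) by simp
  qed
  ultimately show ?thesis unfolding graph_isomorphism_def by blast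
qed

lemma graph_isomorphism_compose:
  assumes "graph_isomorphism f g G H" "graph_isomorphism f' g' H K" "feynman_graph G"
  shows "graph_isomorphism (f' \<circ> f) (g' \<circ> g) G K"
proof -
  have "g e \<in> halves H" if "e \<in> halves G" for e
    using assms(1) that by (auto simp: graph_isomorphism_def bij_betw_def)
  moreover have "f e \<in> verts H" if "e \<in> verts G" for e
    using assms(1) that by (auto simp: graph_isomorphism_def bij_betw_def)
  ultimately show ?thesis
    using assms(1,2) bd_in_verts[OF assms(3)] sigma_in_halves[OF assms(3)]
    unfolding graph_isomorphism_def by (auto intro: bij_betw_trans)
qed

lemma graph_isomorphism_connected:
  assumes iso: "graph_isomorphism f g G H" and G: "feynman_graph G" "connected_graph G"
    and H: "feynman_graph H"
  shows "connected_graph H"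
proof (rule connected_graphI[OF H])
  have f: "f ` verts G = verts H" using iso by (auto simp: graph_isomorphism_def bij_betw_def)
  then show "verts H \<noteq> {}" using connected_graph_nonempty[OF G] by auto
  fix S assume S: "S \<subseteq> verts H" "S \<noteq> {}"
    and cl: "\<And>e. e \<in> halves H \<Longrightarrow> bd H e \<in> S \<Longrightarrow> bd H (sigma H e) \<in> S"
  have "{v \<in> verts G. f v \<in> S} = verts G"
  proof (rule connected_graph_closed_set[OF G])
    show "{v \<in> verts G. f v \<in> S} \<noteq> {}" using S unfolding f[symmetric] by fast
    fix e assume e: "e \<in> halves G" "bd G e \<in> {v \<in> verts G. f v \<in> S}"
    then have "g e \<in> halves H" "bd H (g e) = f (bd G e)" "sigma H (g e) = g (sigma G e)"
      "bd H (g (sigma G e)) = f (bd G (sigma G e))"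
      using iso sigma_in_halves[OF G(1)] by (auto simp: graph_isomorphism_def bij_betw_def)
    then show "bd G (sigma G e) \<in> {v \<in> verts G. f v \<in> S}"
      using cl[of "g e"] e bd_in_verts[OF G(1) sigma_in_halves[OF G(1)]] by auto
  qed auto
  then show "S = verts H" using S(1) unfolding f[symmetric] by fast
qed

text \<open>
  A connected graph has a single index, stored at its set of vertices; isomorphism of
  connected indexed graphs only has to compare these two numbers.
\<close>

lemma isomorphic_connected_iff:
  assumes "connected_feynman_graph (fst X)"
  shows "isomorphic X Y \<longleftrightarrow>
    (\<exists>f g. graph_isomorphism f g (fst X) (fst Y)) \<and> snd Y (verts (fst Y)) = snd X (verts (fst X))"
proof -
  have "f ` verts (fst X) = verts (fst Y)" if "graph_isomorphism f g (fst X) (fst Y)" for f g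
    using that by (auto simp: graph_isomorphism_def bij_betw_def)
  then show ?thesis
    using assms
    by (cases X; cases Y) (fastforce simp: connected_feynman_graph_def components_connected)
qed

lemma isomorphic_connected:
  assumes "isomorphic X Y" "feynman_graph (fst X)" "feynman_graph (fst Y)"
  shows "connected_graph (fst X) \<longleftrightarrow> connected_graph (fst Y)"
proof -
  obtain f g where "graph_isomorphism f g (fst X) (fst Y)"
    using assms(1) by (cases X; cases Y) auto
  then show ?thesis
    using assms(2,3) graph_isomorphism_connected[of _ _ "fst X" "fst Y"]
      graph_isomorphism_connected[of _ _ "fst Y" "fst X"]
      graph_isomorphism_inverse[of _ _ "fst X" "fst Y"] by metis
qed

lemma isomorphic_sym:
  assumes "isomorphic X Y" "connected_feynman_graph (fst X)" "connected_feynman_graph (fst Y)"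
  shows "isomorphic Y X"
proof -
  obtain f g where "graph_isomorphism f g (fst X) (fst Y)"
    and i: "snd Y (verts (fst Y)) = snd X (verts (fst X))"
    using assms(1) by (auto simp: isomorphic_connected_iff[OF assms(2)])
  then have "\<exists>f g. graph_isomorphism f g (fst Y) (fst X)"
    using graph_isomorphism_inverse assms(2) unfolding connected_feynman_graph_def by blast
  with i show ?thesis by (simp add: isomorphic_connected_iff[OF assms(3)])
qed

lemma isomorphic_trans:
  assumes "isomorphic X Y" "isomorphic Y Z"
    "connected_feynman_graph (fst X)" "connected_feynman_graph (fst Y)"
  shows "isomorphic X Z"
proof -
  obtain f g where f: "graph_isomorphism f g (fst X) (fst Y)"
    and i: "snd Y (verts (fst Y)) = snd X (verts (fst X))"
    using assms(1) by (auto simp: isomorphic_connected_iff[OF assms(3)])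
  obtain f' g' where f': "graph_isomorphism f' g' (fst Y) (fst Z)"
    and i': "snd Z (verts (fst Z)) = snd Y (verts (fst Y))"
    using assms(2) by (auto simp: isomorphic_connected_iff[OF assms(4)])
  have "graph_isomorphism (f' \<circ> f) (g' \<circ> g) (fst X) (fst Z)"
    using graph_isomorphism_compose[OF f f'] assms(3) by (simp add: connected_feynman_graph_def)
  with i i' show ?thesis by (auto simp: isomorphic_connected_iff[OF assms(3)])
qed

lemma iso_class_eqI:
  assumes "isomorphic X Y" "connected_feynman_graph (fst X)" "connected_feynman_graph (fst Y)"
  shows "iso_class X = iso_class Y"
proof -
  have "isomorphic Z X \<longleftrightarrow> isomorphic Z Y" if Z: "feynman_graph (fst Z)"
    for Z :: "(nat, nat, 'c) indexed_graph"
  proof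
    assume ZX: "isomorphic Z X"
    then have "connected_feynman_graph (fst Z)"
      using isomorphic_connected[OF ZX Z] assms(2) Z by (simp add: connected_feynman_graph_def)
    then show "isomorphic Z Y" using isomorphic_trans[OF ZX assms(1)] assms(2) by simp
  next
    assume ZY: "isomorphic Z Y"
    then have "connected_feynman_graph (fst Z)"
      using isomorphic_connected[OF ZY Z] assms(3) Z by (simp add: connected_feynman_graph_def)
    then show "isomorphic Z X"
      using isomorphic_trans[OF ZY isomorphic_sym[OF assms]] assms(3) by simp
  qed
  then show ?thesis unfolding iso_class_def by blast
qed

lemma gen_eqI:
  assumes "isomorphic X Y" "connected_feynman_graph (fst X)" "connected_feynman_graph (fst Y)"
  shows "gen X = gen Y"
  using iso_class_eqI[OF assms] by (simp add: gen_def)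

text \<open>
  A finite graph over arbitrary types has a copy over the natural numbers, so the class of a
  composite is represented although the composite itself lives over sum types.
\<close>

lemma iso_class_nonempty:
  assumes "feynman_graph (fst X)"
  shows "\<exists>Y. Y \<in> iso_class X"
proof -
  obtain G i where X: "X = (G, i)" by (cases X)
  have G: "feynman_graph G" using assms by (simp add: X)
  obtain f :: "_ \<Rightarrow> nat" where f: "inj_on f (verts G)"
    using G finite_imp_inj_to_nat_seg unfolding feynman_graph_def by metis
  obtain g :: "_ \<Rightarrow> nat" where g: "inj_on g (halves G)"
    using G finite_imp_inj_to_nat_seg unfolding feynman_graph_def by metis
  define f' where "f' = inv_into (verts G) f"
  define g' where "g' = inv_into (halves G) g"
  define H where "H = \<lparr>verts = f ` verts G, halves = g ` halves G, bd = f \<circ> bd G \<circ> g',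
    sigma = g \<circ> sigma G \<circ> g', htype = htype G \<circ> g', vindex = vindex G \<circ> f'\<rparr>"
  have f'f: "f' (f v) = v" if "v \<in> verts G" for v using that f by (simp add: f'_def)
  have g'g: "g' (g e) = e" if "e \<in> halves G" for e using that g by (simp add: g'_def)
  have "feynman_graph H"
    using G unfolding feynman_graph_def H_def by (auto simp: g'g Pi_iff)
  moreover have "graph_isomorphism f' g' H G"
    unfolding graph_isomorphism_def H_def
    using bij_betw_inv_into[OF inj_on_imp_bij_betw[OF f]]
      bij_betw_inv_into[OF inj_on_imp_bij_betw[OF g]]
    by (simp add: g'g f'f bd_in_verts[OF G] sigma_in_halves[OF G] flip: f'_def g'_def)
  then have "isomorphic (H, \<lambda>C. i (f' ` C)) (G, i)"
    by (simp, intro exI conjI) auto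
  ultimately have "(H, \<lambda>C. i (f' ` C)) \<in> iso_class X"
    unfolding iso_class_def X by simp
  then show ?thesis ..
qed


section \<open>Gluings\<close>

lemma image_mset_mset_set_bij:
  assumes "bij_betw g A B" "\<And>e. e \<in> A \<Longrightarrow> t' (g e) = t e"
  shows "image_mset t' (mset_set B) = image_mset t (mset_set A)"
proof -
  have "mset_set B = image_mset g (mset_set A)"
    using assms(1) by (auto simp: bij_betw_def image_mset_mset_set)
  then show ?thesis
    using assms(2) by (cases "finite A") (auto simp: multiset.map_comp intro!: image_mset_cong)
qed

text \<open>
  The set of gluings depends only on the typed sets of external half-edges and of half-edges
  at the vertex. This turns every identification of such sets into a reindexing of the sums
  that define the insertion product.
\<close>

lemma gluings_bij_target:
  assumes \<psi>: "bij_betw \<psi> (star G2 u) (star H w)"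
    and t: "\<And>h. h \<in> star G2 u \<Longrightarrow> htype H (\<psi> h) = htype G2 h"
  shows "bij_betw (\<lambda>b. \<lambda>e\<in>externals G1. \<psi> (b e)) (gluings G1 G2 u) (gluings G1 H w)"
proof (rule bij_betw_byWitness[where f' = "\<lambda>b. \<lambda>e\<in>externals G1. inv_into (star G2 u) \<psi> (b e)"])
  let ?i = "inv_into (star G2 u) \<psi>"
  have i: "bij_betw ?i (star H w) (star G2 u)" using \<psi> by (rule bij_betw_inv_into)
  have \<psi>i: "\<psi> (?i h) = h" if "h \<in> star H w" for h using \<psi> that by (rule bij_betw_inv_into_right)
  have i\<psi>: "?i (\<psi> h) = h" if "h \<in> star G2 u" for h using \<psi> that by (rule bij_betw_inv_into_left)
  have ti: "htype G2 (?i h) = htype H h" if "h \<in> star H w" for h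
    using t[OF bij_betw_apply[OF i that]] \<psi>i[OF that] by simp
  have b: "b e \<in> star G2 u" if "b \<in> gluings G1 G2 u" "e \<in> externals G1" for b e
    using that by (auto simp: gluings_def bij_betw_def)
  have b': "b e \<in> star H w" if "b \<in> gluings G1 H w" "e \<in> externals G1" for b e
    using that by (auto simp: gluings_def bij_betw_def)
  show "\<forall>b\<in>gluings G1 G2 u. (\<lambda>e\<in>externals G1. ?i ((\<lambda>e\<in>externals G1. \<psi> (b e)) e)) = b"
    using b i\<psi> by (auto simp: gluings_def extensional_def fun_eq_iff)
  show "\<forall>b\<in>gluings G1 H w. (\<lambda>e\<in>externals G1. \<psi> ((\<lambda>e\<in>externals G1. ?i (b e)) e)) = b"
    using b' \<psi>i by (auto simp: gluings_def extensional_def fun_eq_iff)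
  show "(\<lambda>b. \<lambda>e\<in>externals G1. \<psi> (b e)) ` gluings G1 G2 u \<subseteq> gluings G1 H w"
  proof (intro image_subsetI)
    fix b assume "b \<in> gluings G1 G2 u"
    then show "(\<lambda>e\<in>externals G1. \<psi> (b e)) \<in> gluings G1 H w"
      using b[of b] t bij_betw_trans[of b "externals G1" "star G2 u" \<psi>] \<psi>
      by (auto simp: gluings_def comp_def)
  qed
  show "(\<lambda>b. \<lambda>e\<in>externals G1. ?i (b e)) ` gluings G1 H w \<subseteq> gluings G1 G2 u"
  proof (intro image_subsetI)
    fix b assume "b \<in> gluings G1 H w"
    then show "(\<lambda>e\<in>externals G1. ?i (b e)) \<in> gluings G1 G2 u"
      using b'[of b] ti bij_betw_trans[of b "externals G1" "star H w" ?i] i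
      by (auto simp: gluings_def comp_def)
  qed
qed

lemma gluings_bij_source:
  assumes \<phi>: "bij_betw \<phi> (externals H) (externals G1)"
    and t: "\<And>e. e \<in> externals H \<Longrightarrow> htype G1 (\<phi> e) = htype H e"
  shows "bij_betw (\<lambda>b. \<lambda>e\<in>externals H. b (\<phi> e)) (gluings G1 G2 v) (gluings H G2 v)"
proof (rule bij_betw_byWitness[where
    f' = "\<lambda>b. \<lambda>e\<in>externals G1. b (inv_into (externals H) \<phi> e)"])
  let ?i = "inv_into (externals H) \<phi>"
  have i: "bij_betw ?i (externals G1) (externals H)" using \<phi> by (rule bij_betw_inv_into)
  have \<phi>i: "\<phi> (?i e) = e" if "e \<in> externals G1" for e
    using \<phi> that by (rule bij_betw_inv_into_right)
  have i\<phi>: "?i (\<phi> e) = e" if "e \<in> externals H" for e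
    using \<phi> that by (rule bij_betw_inv_into_left)
  have im: "\<phi> e \<in> externals G1" if "e \<in> externals H" for e
    using \<phi> that by (auto simp: bij_betw_def)
  have im': "?i e \<in> externals H" if "e \<in> externals G1" for e
    using i that by (auto simp: bij_betw_def)
  have ti: "htype H (?i e) = htype G1 e" if "e \<in> externals G1" for e
    using t[OF im'[OF that]] \<phi>i[OF that] by simp
  show "\<forall>b\<in>gluings G1 G2 v.
      (\<lambda>e\<in>externals G1. (\<lambda>e\<in>externals H. b (\<phi> e)) (?i e)) = b"
    using im' \<phi>i by (auto simp: gluings_def extensional_def fun_eq_iff)
  show "\<forall>b\<in>gluings H G2 v.
      (\<lambda>e\<in>externals H. (\<lambda>e\<in>externals G1. b (?i e)) (\<phi> e)) = b"
    using im i\<phi> by (auto simp: gluings_def extensional_def fun_eq_iff)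
  show "(\<lambda>b. \<lambda>e\<in>externals H. b (\<phi> e)) ` gluings G1 G2 v \<subseteq> gluings H G2 v"
    using bij_betw_trans[OF \<phi>] t im by (auto simp: gluings_def comp_def)
  show "(\<lambda>b. \<lambda>e\<in>externals G1. b (?i e)) ` gluings H G2 v \<subseteq> gluings G1 G2 v"
    using bij_betw_trans[OF i] ti im' by (auto simp: gluings_def comp_def)
qed

lemma gluing_in_star: "b \<in> gluings G1 G2 v \<Longrightarrow> e \<in> externals G1 \<Longrightarrow> b e \<in> star G2 v"
  by (auto simp: gluings_def bij_betw_def)

lemma gluing_in_halves: "b \<in> gluings G1 G2 v \<Longrightarrow> e \<in> externals G1 \<Longrightarrow> b e \<in> halves G2"
  using gluing_in_star[of b G1 G2 v e] by (simp add: star_def)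

lemma bd_gluing: "b \<in> gluings G1 G2 v \<Longrightarrow> e \<in> externals G1 \<Longrightarrow> bd G2 (b e) = v"
  using gluing_in_star[of b G1 G2 v e] by (simp add: star_def)

lemma htype_gluing: "b \<in> gluings G1 G2 v \<Longrightarrow> e \<in> externals G1 \<Longrightarrow> htype G2 (b e) = htype G1 e"
  by (simp add: gluings_def)

lemma gluing_onto_star:
  assumes "b \<in> gluings G1 G2 v" "h \<in> halves G2" "bd G2 h = v"
  obtains e where "e \<in> externals G1" "h = b e"
proof -
  have "h \<in> b ` externals G1" using assms by (auto simp: gluings_def bij_betw_def star_def)
  then show thesis using that by auto
qed

lemma gluing_eq_iff:
  "b \<in> gluings G1 G2 v \<Longrightarrow> e \<in> externals G1 \<Longrightarrow> e' \<in> externals G1 \<Longrightarrow> b e = b e' \<longleftrightarrow> e = e'"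
  by (auto simp: gluings_def bij_betw_def dest: inj_onD)

section \<open>The graph obtained by an insertion\<close>

lemma replace_vertex_simps [simp]:
  "verts (replace_vertex b G1 v G2) = Inl ` verts G1 \<union> Inr ` (verts G2 - {v})"
  "halves (replace_vertex b G1 v G2) = Inl ` internals G1 \<union> Inr ` halves G2"
  "bd (replace_vertex b G1 v G2) (Inl e) = Inl (bd G1 e)"
  "bd G2 h \<noteq> v \<Longrightarrow> bd (replace_vertex b G1 v G2) (Inr h) = Inr (bd G2 h)"
  "sigma (replace_vertex b G1 v G2) (Inl e) = Inl (sigma G1 e)"
  "sigma (replace_vertex b G1 v G2) (Inr h) = Inr (sigma G2 h)"
  "htype (replace_vertex b G1 v G2) (Inl e) = htype G1 e"
  "htype (replace_vertex b G1 v G2) (Inr h) = htype G2 h"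
  "vindex (replace_vertex b G1 v G2) (Inl x) = vindex G1 x"
  "vindex (replace_vertex b G1 v G2) (Inr y) = vindex G2 y"
  by (simp_all add: replace_vertex_def)

text \<open>
  Every half-edge at the replaced vertex is \<open>b e\<close> for a unique external \<open>e\<close>; in these terms its
  new end point no longer involves the inverse of the gluing.
\<close>

lemma bd_replace_vertex_gluing:
  assumes "b \<in> gluings G1 G2 v" "e \<in> externals G1"
  shows "bd (replace_vertex b G1 v G2) (Inr (b e)) = Inl (bd G1 e)"
proof -
  have "inj_on b (externals G1)" using assms by (auto simp: gluings_def bij_betw_def)
  then show ?thesis
    using bd_gluing[OF assms] assms(2) by (simp add: replace_vertex_def the_inv_into_f_f)
qed

lemma externals_replace_vertex [simp]:
  "externals (replace_vertex b G1 v G2) = Inr ` externals G2"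
  by (auto simp: externals_def internals_def)

lemma internals_replace_vertex:
  "internals (replace_vertex b G1 v G2) = Inl ` internals G1 \<union> Inr ` internals G2"
  by (auto simp: internals_def)

lemma feynman_graph_replace_vertex:
  assumes "feynman_graph G1" "feynman_graph G2" "b \<in> gluings G1 G2 v"
  shows "feynman_graph (replace_vertex b G1 v G2)"
proof -
  let ?R = "replace_vertex b G1 v G2"
  have "bd ?R x \<in> verts ?R" if x: "x \<in> halves ?R" for x
  proof (cases x)
    case (Inl e)
    then show ?thesis using x bd_in_verts[OF assms(1)] by (auto simp: internals_def)
  next
    case (Inr h)
    then have h: "h \<in> halves G2" using x by auto
    show ?thesis
    proof (cases "bd G2 h = v")
      case True
      then obtain e where "e \<in> externals G1" "h = b e" using gluing_onto_star[OF assms(3) h] by blast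
      then show ?thesis
        using Inr bd_in_verts[OF assms(1)] by (simp add: bd_replace_vertex_gluing[OF assms(3)] externals_def)
    next
      case False
      then show ?thesis using Inr h bd_in_verts[OF assms(2)] by auto
    qed
  qed
  moreover have "finite (internals G1)"
    using assms(1) by (simp add: feynman_graph_def internals_def)
  ultimately show ?thesis
    using assms(1,2) unfolding feynman_graph_def[of ?R] 
    by (auto simp: sigma_in_halves sigma_sigma htype_sigma sigma_in_internals internals_in_halves
        simp del: replace_vertex_simps(1))
      (simp_all add: feynman_graph_def)
qed

text \<open>
  Insertion renames the stars of the inserted graph along this map; it is also what turns a
  gluing to a vertex of the inserted graph into a gluing to the same vertex of the composite.
\<close>

definition inserted_half_edge ::
  "('h \<Rightarrow> 'g) \<Rightarrow> ('v, 'h, 't) feynman_graph \<Rightarrow> 'h \<Rightarrow> 'h + 'g" where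
  "inserted_half_edge b G1 e = (if e \<in> externals G1 then Inr (b e) else Inl e)"

lemma star_replace_vertex_Inl:
  assumes "feynman_graph G1" "b \<in> gluings G1 G2 v"
  shows "bij_betw (inserted_half_edge b G1) (star G1 u) (star (replace_vertex b G1 v G2) (Inl u))"
    (is "bij_betw _ _ (star ?R _)")
proof (rule bij_betwI')
  fix e e' assume "e \<in> star G1 u" "e' \<in> star G1 u"
  then show "inserted_half_edge b G1 e = inserted_half_edge b G1 e' \<longleftrightarrow> e = e'"
    using gluing_eq_iff[OF assms(2)] by (auto simp: inserted_half_edge_def)
next
  fix e assume "e \<in> star G1 u"
  then show "inserted_half_edge b G1 e \<in> star ?R (Inl u)"
    using gluing_in_halves[OF assms(2)] bd_replace_vertex_gluing[OF assms(2)]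
    by (auto simp: inserted_half_edge_def star_def internals_def externals_def)
next
  fix x assume x: "x \<in> star ?R (Inl u)"
  show "\<exists>e\<in>star G1 u. x = inserted_half_edge b G1 e"
  proof (cases x)
    case (Inl e)
    then have "e \<in> internals G1" "bd G1 e = u" using x by (auto simp: star_def)
    then show ?thesis
      using Inl by (auto simp: star_def inserted_half_edge_def internals_def externals_def)
  next
    case (Inr h)
    then have h: "h \<in> halves G2" "bd ?R (Inr h) = Inl u" using x by (auto simp: star_def)
    then have "bd G2 h = v" by (cases "bd G2 h = v") auto
    then obtain e where e: "e \<in> externals G1" "h = b e"
      using gluing_onto_star[OF assms(2) h(1)] by blast
    then have "bd G1 e = u" using h(2) by (simp add: bd_replace_vertex_gluing[OF assms(2)])
    then show ?thesis
      using Inr e by (auto simp: star_def inserted_half_edge_def externals_def)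
  qed
qed

lemma htype_inserted_half_edge:
  assumes "b \<in> gluings G1 G2 v"
  shows "htype (replace_vertex b G1 v G2) (inserted_half_edge b G1 e) = htype G1 e"
  using htype_gluing[OF assms] by (simp add: inserted_half_edge_def)

lemma star_replace_vertex_Inr:
  assumes "b \<in> gluings G1 G2 v" "w \<noteq> v"
  shows "bij_betw Inr (star G2 w) (star (replace_vertex b G1 v G2) (Inr w))"
    (is "bij_betw _ _ (star ?R _)")
proof (rule bij_betwI')
  fix x assume x: "x \<in> star ?R (Inr w)"
  then obtain h where h: "x = Inr h" "h \<in> halves G2" by (auto simp: star_def)
  have "bd G2 h \<noteq> v"
  proof
    assume "bd G2 h = v"
    then obtain e where "e \<in> externals G1" "h = b e" using gluing_onto_star[OF assms(1) h(2)] by blast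
    then show False using x h by (simp add: star_def bd_replace_vertex_gluing[OF assms(1)])
  qed
  then show "\<exists>h\<in>star G2 w. x = Inr h" using x h by (auto simp: star_def)
qed (use assms in \<open>auto simp: star_def\<close>)

lemma vertex_type_replace_vertex_Inl:
  assumes "feynman_graph G1" "b \<in> gluings G1 G2 v"
  shows "vertex_type (replace_vertex b G1 v G2) (Inl u) = vertex_type G1 u"
  unfolding vertex_type_def
  by (simp add: image_mset_mset_set_bij[OF star_replace_vertex_Inl[OF assms]]
      htype_inserted_half_edge[OF assms(2)])

lemma vertex_type_replace_vertex_Inr:
  assumes "b \<in> gluings G1 G2 v" "w \<noteq> v"
  shows "vertex_type (replace_vertex b G1 v G2) (Inr w) = vertex_type G2 w"
  unfolding vertex_type_def
  by (simp add: image_mset_mset_set_bij[OF star_replace_vertex_Inr[OF assms]])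

text \<open>
  Contracting a connected part \<open>A\<close> of \<open>K\<close> to the vertex \<open>v\<close> reflects connectedness: a closed set
  of vertices of \<open>K\<close> contains all of \<open>A\<close> or none of it, and hence comes from a closed set of the
  contracted graph \<open>B\<close>. The half-edges of \<open>K\<close> are left open so that the same argument serves
  after an internal edge on either side has been cut.
\<close>

lemma connected_graph_by_contraction:
  fixes A :: "('v, 'h, 't) feynman_graph" and B :: "('w, 'g, 't) feynman_graph"
    and K :: "('v + 'w, 'h + 'g, 't) feynman_graph"
  assumes A: "feynman_graph A" "connected_graph A" and B: "feynman_graph B" "connected_graph B"
    and K: "feynman_graph K" and v: "v \<in> verts B"
    and vK: "verts K = Inl ` verts A \<union> Inr ` (verts B - {v})"
    and eA: "\<And>e. e \<in> internals A \<Longrightarrow>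
      Inl e \<in> halves K \<and> bd K (Inl e) = Inl (bd A e) \<and> sigma K (Inl e) = Inl (sigma A e)"
    and eB: "\<And>h. h \<in> halves B \<Longrightarrow>
      Inr h \<in> halves K \<and> case_sum (\<lambda>_. v) (\<lambda>w. w) (bd K (Inr h)) = bd B h \<and>
      sigma K (Inr h) = Inr (sigma B h)"
  shows "connected_graph K"
proof (rule connected_graphI[OF K])
  let ?c = "case_sum (\<lambda>_. v) (\<lambda>w. w) :: 'v + 'w \<Rightarrow> 'w"
  have neA: "verts A \<noteq> {}" using connected_graph_nonempty A by blast
  then show "verts K \<noteq> {}" by (auto simp: vK)
  fix S assume S: "S \<subseteq> verts K" "S \<noteq> {}"
    and cl: "\<And>e. e \<in> halves K \<Longrightarrow> bd K e \<in> S \<Longrightarrow> bd K (sigma K e) \<in> S"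
  have whole: "Inl ` verts A \<subseteq> S" if "Inl x \<in> S" for x
  proof -
    have "{y \<in> verts A. Inl y \<in> S} = verts A"
    proof (rule connected_graph_closed_set[OF A])
      show "{y \<in> verts A. Inl y \<in> S} \<noteq> {}" using that S vK by auto
      fix e assume e: "e \<in> halves A" "bd A e \<in> {y \<in> verts A. Inl y \<in> S}"
      show "bd A (sigma A e) \<in> {y \<in> verts A. Inl y \<in> S}"
      proof (cases "sigma A e = e")
        case False
        then have "e \<in> internals A" using e by (simp add: internals_def)
        then show ?thesis
          using eA[of e] eA[of "sigma A e"] sigma_in_internals[OF A(1), of e] e cl[of "Inl e"]
            bd_in_verts[OF A(1) sigma_in_halves[OF A(1)]] by auto
      qed (use e in simp)
    qed auto
    then show ?thesis by auto
  qed
  have cK: "?c y \<in> verts B" if "y \<in> verts K" for y using that v vK by auto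
  \<comment> \<open>\<open>S\<close> is a union of fibres of the contraction.\<close>
  have reflects: "y \<in> S" if "?c y \<in> ?c ` S" "y \<in> verts K" for y
  proof -
    from that(1) obtain x where "?c y = ?c x" "x \<in> S" by (rule imageE)
    then show ?thesis using S that(2) whole vK by (cases x; cases y) (auto)
  qed
  have "?c ` S = verts B"
  proof (rule connected_graph_closed_set[OF B])
    show "?c ` S \<subseteq> verts B" using S cK by auto
    show "?c ` S \<noteq> {}" using S by auto
    fix h assume h: "h \<in> halves B" "bd B h \<in> ?c ` S"
    have "bd K (Inr h) \<in> S"
      using reflects[of "bd K (Inr h)"] eB[OF h(1)] h(2) bd_in_verts[OF K] by auto
    then have "bd K (Inr (sigma B h)) \<in> S" using cl[of "Inr h"] eB[OF h(1)] by auto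
    then show "bd B (sigma B h) \<in> ?c ` S"
      using eB[OF sigma_in_halves[OF B(1) h(1)]] by (auto intro: rev_image_eqI)
  qed
  then show "S = verts K" using reflects cK S by blast
qed

lemma contract_bd_replace_vertex:
  assumes "b \<in> gluings G1 G2 v" "h \<in> halves G2"
  shows "case_sum (\<lambda>_. v) (\<lambda>w. w) (bd (replace_vertex b G1 v G2) (Inr h)) = bd G2 h"
proof (cases "bd G2 h = v")
  case True
  then obtain e where "e \<in> externals G1" "h = b e" using gluing_onto_star[OF assms] by blast
  then show ?thesis using True by (simp add: bd_replace_vertex_gluing[OF assms(1)])
qed auto

lemma connected_replace_vertex:
  assumes "connected_feynman_graph G1" "connected_feynman_graph G2"
    and "b \<in> gluings G1 G2 v" "v \<in> verts G2"
  shows "connected_feynman_graph (replace_vertex b G1 v G2)"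
proof -
  have G: "feynman_graph G1" "connected_graph G1" "feynman_graph G2" "connected_graph G2"
    using assms by (auto simp: connected_feynman_graph_def)
  have R: "feynman_graph (replace_vertex b G1 v G2)"
    using feynman_graph_replace_vertex[OF G(1,3) assms(3)] .
  have "connected_graph (replace_vertex b G1 v G2)"
    by (rule connected_graph_by_contraction[OF G R assms(4)])
      (auto simp: contract_bd_replace_vertex[OF assms(3)])
  with R show ?thesis by (simp add: connected_feynman_graph_def)
qed

text \<open>
  An internal edge of the composite is internal in exactly one of the two graphs. Cutting it
  there leaves that graph connected, and the contraction argument applies to the cut graph
  together with the other one.
\<close>

lemma one_PI_replace_vertex:
  assumes G: "feynman_graph G1" "feynman_graph G2" "one_PI G1" "one_PI G2"
    and b: "b \<in> gluings G1 G2 v" "v \<in> verts G2"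
  shows "one_PI (replace_vertex b G1 v G2)" (is "one_PI ?R")
proof -
  have c: "connected_graph G1" "connected_graph G2" using G by (auto simp: one_PI_def)
  have R: "feynman_graph ?R" using feynman_graph_replace_vertex[OF G(1,2) b(1)] .
  have "connected_graph (cut ?R (Inl e))" if e: "e \<in> internals G1" for e
  proof (rule connected_graph_by_contraction[of "cut G1 e" G2 _ v])
    show "feynman_graph (cut G1 e)" "feynman_graph (cut ?R (Inl e))"
      using e feynman_graph_cut[OF G(1), of e] feynman_graph_cut[OF R, of "Inl e"]
      by (auto simp: internals_def)
    show "connected_graph (cut G1 e)" using e G(3) by (simp add: one_PI_def)
    fix e' assume e': "e' \<in> internals (cut G1 e)"
    then have "e' \<in> halves G1" "e' \<noteq> e" "e' \<noteq> sigma G1 e" "sigma G1 e' \<noteq> e'"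
      by (auto simp: internals_def cut_def split: if_splits)
    then show "Inl e' \<in> halves (cut ?R (Inl e)) \<and>
        bd (cut ?R (Inl e)) (Inl e') = Inl (bd (cut G1 e) e') \<and>
        sigma (cut ?R (Inl e)) (Inl e') = Inl (sigma (cut G1 e) e')"
      by (auto simp: cut_def internals_def)
  qed (use G c b in \<open>auto simp: cut_def contract_bd_replace_vertex\<close>)
  moreover have "connected_graph (cut ?R (Inr h))" if h: "h \<in> internals G2" for h
  proof (rule connected_graph_by_contraction[of G1 "cut G2 h" _ v])
    show "feynman_graph (cut G2 h)" "feynman_graph (cut ?R (Inr h))"
      using h feynman_graph_cut[OF G(2), of h] feynman_graph_cut[OF R, of "Inr h"]
      by (auto simp: internals_def)
    show "connected_graph (cut G2 h)" using h G(4) by (simp add: one_PI_def)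
  qed (use G c b in \<open>auto simp: cut_def contract_bd_replace_vertex\<close>)
  moreover have "connected_graph ?R"
    using connected_replace_vertex[OF _ _ b] G c by (simp add: connected_feynman_graph_def)
  ultimately show ?thesis by (auto simp: one_PI_def internals_replace_vertex)
qed

lemma fst_insert_along [simp]:
  "fst (insert_along b X v Y) = replace_vertex b (fst X) v (fst Y)"
  by (cases X; cases Y) simp

lemma connected_insert_along:
  assumes "connected_feynman_graph (fst X)" "connected_feynman_graph (fst Y)"
    and "b \<in> gluings (fst X) (fst Y) v" "v \<in> verts (fst Y)"
  shows "connected_feynman_graph (fst (insert_along b X v Y))"
  using connected_replace_vertex[OF assms] by simp

text \<open>
  The contraction maps the vertices of the composite onto those of \<open>Y\<close>; this needs the inserted
  graph to be nonempty, for otherwise the replaced vertex would be missed.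
\<close>

lemma index_insert_along:
  assumes "connected_feynman_graph (fst X)" "v \<in> verts (fst Y)"
  shows "snd (insert_along b X v Y) (verts (fst (insert_along b X v Y))) = snd Y (verts (fst Y))"
proof -
  have "verts (fst X) \<noteq> {}"
    using assms(1) connected_graph_nonempty by (auto simp: connected_feynman_graph_def)
  then have "case_sum (\<lambda>_. v) (\<lambda>w. w) ` verts (replace_vertex b (fst X) v (fst Y)) = verts (fst Y)"
    using assms(2) by (force simp: image_Un image_image)
  then show ?thesis by (cases X; cases Y) simp
qed

lemma residue_type_insert_along:
  assumes "connected_feynman_graph (fst X)" "connected_feynman_graph (fst Y)"
    and "b \<in> gluings (fst X) (fst Y) v" "v \<in> verts (fst Y)"
  shows "residue_type (insert_along b X v Y) = residue_type Y"
proof -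
  have "bij_betw Inr (externals (fst Y)) (Inr ` externals (fst Y))"
    by (simp add: bij_betw_def inj_on_def)
  then have "image_mset (htype (replace_vertex b (fst X) v (fst Y))) (mset_set (Inr ` externals (fst Y)))
      = image_mset (htype (fst Y)) (mset_set (externals (fst Y)))"
    by (rule image_mset_mset_set_bij) simp
  then show ?thesis
    using residue_type_connected[OF connected_insert_along[OF assms]]
      residue_type_connected[OF assms(2)] index_insert_along[OF assms(1,4)] by simp
qed

text \<open>
  The stars of the composite carry the same types as those of the two graphs, and its residue
  is that of the outer graph.
\<close>

lemma connected_specified_insert_along:
  assumes X: "connected_specified_graph T X" and Y: "connected_specified_graph T Y"
    and b: "b \<in> gluings (fst X) (fst Y) v" "v \<in> verts (fst Y)"
  shows "connected_specified_graph T (insert_along b X v Y)"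
proof -
  have G: "feynman_graph (fst X)" "feynman_graph (fst Y)" "one_PI (fst X)" "one_PI (fst Y)"
    and c: "connected_feynman_graph (fst X)" "connected_feynman_graph (fst Y)"
    using X Y connected_specified_graph_connected[OF X] connected_specified_graph_connected[OF Y]
    by (auto simp: connected_specified_graph_iff graph_of_theory_def)
  have "vertex_type (replace_vertex b (fst X) v (fst Y)) (Inr w) \<in> vertex_types T"
    if "w \<in> verts (fst Y)" "w \<noteq> v" for w
    using that Y by (simp add: connected_specified_graph_iff graph_of_theory_def
        vertex_type_replace_vertex_Inr[OF b(1)])
  then have "graph_of_theory T (replace_vertex b (fst X) v (fst Y))"
    using X Y feynman_graph_replace_vertex[OF G(1,2) b(1)]
    by (auto simp: connected_specified_graph_iff graph_of_theory_def internals_def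
        vertex_type_replace_vertex_Inl[OF G(1) b(1)])
  moreover have "residue_type (insert_along b X v Y) \<in> vertex_types T"
    using Y residue_type_insert_along[OF c b] by (simp add: connected_specified_graph_iff)
  ultimately show ?thesis
    using one_PI_replace_vertex[OF G b] by (simp add: connected_specified_graph_iff)
qed

section \<open>Insertion respects isomorphisms\<close>

lemma graph_isomorphism_bij_externals:
  assumes "graph_isomorphism f g G H" "feynman_graph G"
  shows "bij_betw g (externals G) (externals H)"
proof -
  have g: "inj_on g (halves G)" "g ` halves G = halves H"
    and s: "\<And>e. e \<in> halves G \<Longrightarrow> sigma H (g e) = g (sigma G e)"
    using assms by (auto simp: graph_isomorphism_def bij_betw_def)
  have "inj_on g (externals G)" using g(1) by (rule inj_on_subset) (auto simp: externals_def)
  moreover have "g e \<in> externals H \<longleftrightarrow> e \<in> externals G" if "e \<in> halves G" for e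
    using that g s sigma_in_halves[OF assms(2) that]
    by (auto simp: externals_def inj_on_eq_iff[OF g(1)])
  moreover have "externals G \<subseteq> halves G" "externals H \<subseteq> g ` halves G"
    using g(2) by (auto simp: externals_def)
  ultimately have "inj_on g (externals G)" "g ` externals G = externals H" by (simp, fast)
  then show ?thesis by (simp add: bij_betw_def)
qed

lemma graph_isomorphism_bij_internals:
  assumes "graph_isomorphism f g G H" "feynman_graph G"
  shows "bij_betw g (internals G) (internals H)"
proof -
  have e: "bij_betw g (externals G) (externals H)"
    using graph_isomorphism_bij_externals[OF assms] .
  have g: "bij_betw g (halves G) (halves H)"
    using assms by (auto simp: graph_isomorphism_def)
  have "internals G = halves G - externals G" "internals H = halves H - externals H"
    by (auto simp: internals_def externals_def)
  then show ?thesis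
    using e g by (auto intro!: bij_betw_DiffI simp: externals_def)
qed

lemma graph_isomorphism_bij_star:
  assumes "graph_isomorphism f g G H" "feynman_graph G" "v \<in> verts G"
  shows "bij_betw g (star G v) (star H (f v))"
proof -
  have g: "inj_on g (halves G)" "g ` halves G = halves H" and f: "inj_on f (verts G)"
    and s: "\<And>e. e \<in> halves G \<Longrightarrow> bd H (g e) = f (bd G e)"
    using assms by (auto simp: graph_isomorphism_def bij_betw_def)
  have "inj_on g (star G v)" using g(1) by (rule inj_on_subset) (auto simp: star_def)
  moreover have "g e \<in> star H (f v) \<longleftrightarrow> e \<in> star G v" if "e \<in> halves G" for e
    using that g s bd_in_verts[OF assms(2) that] assms(3)
    by (auto simp: star_def inj_on_eq_iff[OF f])
  moreover have "star G v \<subseteq> halves G" "star H (f v) \<subseteq> g ` halves G"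
    using g(2) by (auto simp: star_def)
  ultimately have "inj_on g (star G v)" "g ` star G v = star H (f v)" by (simp, fast)
  then show ?thesis by (simp add: bij_betw_def)
qed

lemma graph_isomorphism_vertex_type:
  assumes "graph_isomorphism f g G H" "feynman_graph G" "v \<in> verts G"
  shows "vertex_type H (f v) = vertex_type G v"
proof -
  have "htype H (g e) = htype G e" if "e \<in> star G v" for e
    using assms(1) that by (auto simp: graph_isomorphism_def star_def)
  then have "image_mset (htype H) (mset_set (star H (f v)))
      = image_mset (htype G) (mset_set (star G v))"
    by (rule image_mset_mset_set_bij[OF graph_isomorphism_bij_star[OF assms]])
  then show ?thesis using assms by (simp add: vertex_type_def graph_isomorphism_def)
qed

lemma residue_type_isomorphic:
  assumes "isomorphic X Y" "connected_feynman_graph (fst X)" "connected_feynman_graph (fst Y)"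
  shows "residue_type Y = residue_type X"
proof -
  obtain f g where iso: "graph_isomorphism f g (fst X) (fst Y)"
    and i: "snd Y (verts (fst Y)) = snd X (verts (fst X))"
    using assms(1) by (auto simp: isomorphic_connected_iff[OF assms(2)])
  have "htype (fst Y) (g e) = htype (fst X) e" if "e \<in> externals (fst X)" for e
    using iso that by (auto simp: graph_isomorphism_def externals_def)
  moreover have "feynman_graph (fst X)" using assms(2) by (simp add: connected_feynman_graph_def)
  ultimately have "image_mset (htype (fst Y)) (mset_set (externals (fst Y)))
      = image_mset (htype (fst X)) (mset_set (externals (fst X)))"
    using image_mset_mset_set_bij[OF graph_isomorphism_bij_externals[OF iso]] by blast
  with i show ?thesis
    by (simp add: residue_type_connected[OF assms(2)] residue_type_connected[OF assms(3)])
qed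

lemma bij_betw_map_sum:
  assumes "bij_betw f A B" "bij_betw g C D"
  shows "bij_betw (map_sum f g) (Inl ` A \<union> Inr ` C) (Inl ` B \<union> Inr ` D)"
proof -
  have "map_sum f g ` (Inl ` A \<union> Inr ` C) = Inl ` f ` A \<union> Inr ` g ` C"
    by (simp add: image_Un image_image)
  moreover have "inj_on (map_sum f g) (Inl ` A \<union> Inr ` C)"
    using assms by (auto intro!: inj_onI simp: bij_betw_def dest: inj_onD)
  ultimately show ?thesis using assms by (simp add: bij_betw_def)
qed

lemma graph_isomorphism_replace_vertex:
  assumes 1: "graph_isomorphism f1 g1 G1 H1" "feynman_graph G1"
    and 2: "graph_isomorphism f2 g2 G2 H2" "feynman_graph G2"
    and v: "v \<in> verts G2" and b: "b \<in> gluings G1 G2 v" and c: "c \<in> gluings H1 H2 (f2 v)"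
    and cb: "\<And>e. e \<in> externals G1 \<Longrightarrow> c (g1 e) = g2 (b e)"
  shows "graph_isomorphism (map_sum f1 f2) (map_sum g1 g2)
    (replace_vertex b G1 v G2) (replace_vertex c H1 (f2 v) H2)"
    (is "graph_isomorphism ?f ?g ?G ?H")
proof -
  have f2: "bij_betw f2 (verts G2) (verts H2)" using 2 by (simp add: graph_isomorphism_def)
  then have "bij_betw f2 (verts G2 - {v}) (verts H2 - {f2 v})"
    using v by (auto intro!: bij_betw_DiffI simp: bij_betw_apply)
  then have "bij_betw ?f (verts ?G) (verts ?H)"
    using 1 by (simp add: graph_isomorphism_def bij_betw_map_sum)
  moreover have "bij_betw ?g (halves ?G) (halves ?H)"
    using graph_isomorphism_bij_internals[OF 1] 2
    by (simp add: graph_isomorphism_def bij_betw_map_sum)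
  moreover have "bd ?H (?g x) = ?f (bd ?G x) \<and> sigma ?H (?g x) = ?g (sigma ?G x) \<and>
      htype ?H (?g x) = htype ?G x" if x: "x \<in> halves ?G" for x
  proof (cases x)
    case (Inl e)
    then show ?thesis using x 1 by (auto simp: graph_isomorphism_def internals_def)
  next
    case (Inr h)
    then have h: "h \<in> halves G2" using x by auto
    have "bd ?H (?g x) = ?f (bd ?G x)"
    proof (cases "bd G2 h = v")
      case True
      then obtain e where e: "e \<in> externals G1" "h = b e" using gluing_onto_star[OF b h] by blast
      then have "g1 e \<in> externals H1"
        using graph_isomorphism_bij_externals[OF 1] by (auto simp: bij_betw_def)
      then have "bd ?H (Inr (c (g1 e))) = Inl (bd H1 (g1 e))"
        by (rule bd_replace_vertex_gluing[OF c])
      then show ?thesis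
        using e 1 Inr
        by (simp add: bd_replace_vertex_gluing[OF b] cb graph_isomorphism_def externals_def)
    next
      case False
      have "bd H2 (g2 h) = f2 (bd G2 h)" using 2 h by (simp add: graph_isomorphism_def)
      moreover have "f2 (bd G2 h) \<noteq> f2 v"
        using False f2 v bd_in_verts[OF 2(2) h] by (auto simp: bij_betw_def dest: inj_onD)
      ultimately show ?thesis using Inr False by simp
    qed
    then show ?thesis using Inr h 2 by (auto simp: graph_isomorphism_def)
  qed
  moreover have "vindex ?H (?f x) = vindex ?G x" if "x \<in> verts ?G" for x
    using that 1 2 by (auto simp: graph_isomorphism_def)
  ultimately show ?thesis by (auto simp: graph_isomorphism_def)
qed

text \<open>
  The case distinction on types belongs to the summation range, so that all sums of insertions
  are reindexed by the same two lemmas.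
\<close>

definition matching_gluings ::
  "('v, 'h, 't) indexed_graph \<Rightarrow> ('w, 'g, 't) indexed_graph \<Rightarrow> 'w \<Rightarrow> ('h \<Rightarrow> 'g) set" where
  "matching_gluings X Y v =
     (if vertex_type (fst Y) v = residue_type X then gluings (fst X) (fst Y) v else {})"

lemma matching_gluings_gluings: "b \<in> matching_gluings X Y v \<Longrightarrow> b \<in> gluings (fst X) (fst Y) v"
  by (simp add: matching_gluings_def split: if_splits)

lemma insert_at_eq_sum:
  "insert_at X v Y = (\<Sum>b\<in>matching_gluings X Y v. gen (insert_along b X v Y))"
  by (simp add: insert_at_def matching_gluings_def)

lemma matching_gluings_bij_target:
  assumes "bij_betw \<psi> (star (fst Y) u) (star (fst Z) w)"
    and "\<And>h. h \<in> star (fst Y) u \<Longrightarrow> htype (fst Z) (\<psi> h) = htype (fst Y) h"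
    and "vertex_type (fst Z) w = vertex_type (fst Y) u"
  shows "bij_betw (\<lambda>b. \<lambda>e\<in>externals (fst X). \<psi> (b e))
    (matching_gluings X Y u) (matching_gluings X Z w)"
  using gluings_bij_target[OF assms(1,2), of "fst X"] assms(3)
  by (simp add: matching_gluings_def bij_betw_def)

lemma matching_gluings_bij_source:
  assumes "bij_betw \<phi> (externals (fst X')) (externals (fst X))"
    and "\<And>e. e \<in> externals (fst X') \<Longrightarrow> htype (fst X) (\<phi> e) = htype (fst X') e"
    and "residue_type X' = residue_type X"
  shows "bij_betw (\<lambda>b. \<lambda>e\<in>externals (fst X'). b (\<phi> e))
    (matching_gluings X Y v) (matching_gluings X' Y v)"
  using gluings_bij_source[OF assms(1,2), of "fst Y" v] assms(3)
  by (simp add: matching_gluings_def bij_betw_def)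

text \<open>
  The pattern of every comparison of composites below: an isomorphism of the underlying graphs
  together with equality of the indices of the two outer graphs.
\<close>

lemma gen_insert_along_eqI:
  assumes "connected_feynman_graph (fst X)" "connected_feynman_graph (fst Y)"
    and b: "b \<in> gluings (fst X) (fst Y) v" "v \<in> verts (fst Y)"
    and "connected_feynman_graph (fst X')" "connected_feynman_graph (fst Y')"
    and c: "c \<in> gluings (fst X') (fst Y') w" "w \<in> verts (fst Y')"
    and iso: "graph_isomorphism f g (replace_vertex b (fst X) v (fst Y))
      (replace_vertex c (fst X') w (fst Y'))"
    and index: "snd Y (verts (fst Y)) = snd Y' (verts (fst Y'))"
  shows "gen (insert_along b X v Y) = gen (insert_along c X' w Y')"
proof (rule gen_eqI)
  show X: "connected_feynman_graph (fst (insert_along b X v Y))"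
    by (rule connected_insert_along[OF assms(1,2) b])
  show "connected_feynman_graph (fst (insert_along c X' w Y'))"
    by (rule connected_insert_along[OF assms(5,6) c])
  show "isomorphic (insert_along b X v Y) (insert_along c X' w Y')"
    unfolding isomorphic_connected_iff[OF X]
    using iso index index_insert_along[OF assms(1) b(2)] index_insert_along[OF assms(5) c(2)]
    by auto
qed

lemma graph_isomorphism_id: "graph_isomorphism id id G G"
  by (simp add: graph_isomorphism_def)

lemma insert_graph_isomorphic_right:
  assumes Y: "isomorphic Y Y'" and c: "connected_feynman_graph (fst X)"
    "connected_feynman_graph (fst Y)" "connected_feynman_graph (fst Y')"
  shows "insert_graph X Y = insert_graph X Y'"
proof -
  obtain f g where iso: "graph_isomorphism f g (fst Y) (fst Y')"
    and i: "snd Y' (verts (fst Y')) = snd Y (verts (fst Y))"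
    using Y by (auto simp: isomorphic_connected_iff[OF c(2)])
  have F: "feynman_graph (fst X)" "feynman_graph (fst Y)"
    using c by (auto simp: connected_feynman_graph_def)
  have f: "bij_betw f (verts (fst Y)) (verts (fst Y'))" using iso by (simp add: graph_isomorphism_def)
  have "insert_at X v Y = insert_at X (f v) Y'" if v: "v \<in> verts (fst Y)" for v
  proof -
    let ?b' = "\<lambda>b. \<lambda>e\<in>externals (fst X). g (b e)"
    have bij: "bij_betw ?b' (matching_gluings X Y v) (matching_gluings X Y' (f v))"
    proof (rule matching_gluings_bij_target)
      show "bij_betw g (star (fst Y) v) (star (fst Y') (f v))"
        using graph_isomorphism_bij_star[OF iso F(2) v] .
      show "vertex_type (fst Y') (f v) = vertex_type (fst Y) v"
        using graph_isomorphism_vertex_type[OF iso F(2) v] .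
      show "htype (fst Y') (g h) = htype (fst Y) h" if "h \<in> star (fst Y) v" for h
        using that iso by (auto simp: graph_isomorphism_def star_def)
    qed
    have "gen (insert_along b X v Y) = gen (insert_along (?b' b) X (f v) Y')"
      if "b \<in> matching_gluings X Y v" for b
    proof (rule gen_insert_along_eqI[OF c(1,2) _ v c(1,3)])
      show b: "b \<in> gluings (fst X) (fst Y) v" using matching_gluings_gluings[OF that] .
      show b': "?b' b \<in> gluings (fst X) (fst Y') (f v)"
        using matching_gluings_gluings[OF bij_betw_apply[OF bij that]] .
      show "f v \<in> verts (fst Y')" using f v by (rule bij_betw_apply)
      show "graph_isomorphism (map_sum id f) (map_sum id g) (replace_vertex b (fst X) v (fst Y))
          (replace_vertex (?b' b) (fst X) (f v) (fst Y'))"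
        by (rule graph_isomorphism_replace_vertex[OF graph_isomorphism_id F(1) iso F(2) v b b']) simp
    qed (use i in simp)
    then show ?thesis
      unfolding insert_at_eq_sum sum.reindex_bij_betw[OF bij, symmetric] by (rule sum.cong[OF refl])
  qed
  then show ?thesis
    unfolding insert_graph_def sum.reindex_bij_betw[OF f, symmetric] by (rule sum.cong[OF refl])
qed

lemma insert_graph_isomorphic_left:
  assumes X: "isomorphic X X'" and c: "connected_feynman_graph (fst X)"
    "connected_feynman_graph (fst X')" "connected_feynman_graph (fst Y)"
  shows "insert_graph X Y = insert_graph X' Y"
proof -
  obtain f g where iso: "graph_isomorphism f g (fst X) (fst X')"
    using X by (auto simp: isomorphic_connected_iff[OF c(1)])
  have F: "feynman_graph (fst X)" "feynman_graph (fst Y)"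
    using c by (auto simp: connected_feynman_graph_def)
  have g: "bij_betw g (externals (fst X)) (externals (fst X'))"
    using graph_isomorphism_bij_externals[OF iso F(1)] .
  have "insert_at X v Y = insert_at X' v Y" if v: "v \<in> verts (fst Y)" for v
  proof -
    let ?b' = "\<lambda>b. \<lambda>e\<in>externals (fst X). b (g e)"
    have bij: "bij_betw ?b' (matching_gluings X' Y v) (matching_gluings X Y v)"
    proof (rule matching_gluings_bij_source[OF g])
      show "residue_type X = residue_type X'" using residue_type_isomorphic[OF X c(1,2)] by simp
      show "htype (fst X') (g e) = htype (fst X) e" if "e \<in> externals (fst X)" for e
        using that iso by (auto simp: graph_isomorphism_def externals_def)
    qed
    have "gen (insert_along (?b' b) X v Y) = gen (insert_along b X' v Y)"
      if "b \<in> matching_gluings X' Y v" for b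
    proof (rule gen_insert_along_eqI[OF c(1,3) _ v c(2,3) _ v])
      show b: "b \<in> gluings (fst X') (fst Y) v" using matching_gluings_gluings[OF that] .
      show b': "?b' b \<in> gluings (fst X) (fst Y) v"
        using matching_gluings_gluings[OF bij_betw_apply[OF bij that]] .
      show "graph_isomorphism (map_sum f id) (map_sum g id)
          (replace_vertex (?b' b) (fst X) v (fst Y)) (replace_vertex b (fst X') v (fst Y))"
        using graph_isomorphism_replace_vertex[OF iso F(1) graph_isomorphism_id F(2) v b', of b] b
        by simp
    qed simp
    then show ?thesis
      unfolding insert_at_eq_sum sum.reindex_bij_betw[OF bij, symmetric]
      by (auto intro: sum.cong)
  qed
  then show ?thesis unfolding insert_graph_def by (rule sum.cong[OF refl])
qed

section \<open>Two successive insertions\<close>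

fun sum_assoc :: "('a + 'b) + 'c \<Rightarrow> 'a + ('b + 'c)" where
  "sum_assoc (Inl (Inl x)) = Inl x"
| "sum_assoc (Inl (Inr y)) = Inr (Inl y)"
| "sum_assoc (Inr z) = Inr (Inr z)"

fun sum_exchange :: "'a + ('b + 'c) \<Rightarrow> 'b + ('a + 'c)" where
  "sum_exchange (Inl x) = Inr (Inl x)"
| "sum_exchange (Inr (Inl y)) = Inl y"
| "sum_exchange (Inr (Inr z)) = Inr (Inr z)"

lemma inj_sum_assoc: "inj_on sum_assoc A"
proof (rule inj_onI)
  show "x = y" if "sum_assoc x = sum_assoc y" for x y :: "('a + 'b) + 'c"
    using that by (cases x rule: sum_assoc.cases; cases y rule: sum_assoc.cases) auto
qed

lemma inj_sum_exchange: "inj_on sum_exchange A"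
proof (rule inj_onI)
  show "x = y" if "sum_exchange x = sum_exchange y" for x y :: "'a + ('b + 'c)"
    using that by (cases x rule: sum_exchange.cases; cases y rule: sum_exchange.cases) auto
qed

text \<open>
  Inserting \<open>G1\<close> into \<open>G2\<close> and the result into \<open>G3\<close> amounts to inserting \<open>G2\<close> into \<open>G3\<close> and then
  \<open>G1\<close> at a vertex coming from \<open>G2\<close>. The gluings correspond because the external half-edges of
  the first composite are those of \<open>G2\<close>, and because the star of a vertex of \<open>G2\<close> only has its
  external half-edges renamed when \<open>G2\<close> is inserted.
\<close>

lemma graph_isomorphism_insert_assoc:
  assumes b: "b \<in> gluings G1 G2 u" and u: "u \<in> verts G2"
    and c: "c \<in> gluings (replace_vertex b G1 u G2) G3 v" and c': "c' \<in> gluings G2 G3 v"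
    and b': "b' \<in> gluings G1 (replace_vertex c' G2 v G3) (Inl u)"
    and cc': "\<And>h. h \<in> externals G2 \<Longrightarrow> c (Inr h) = c' h"
    and bb': "\<And>e. e \<in> externals G1 \<Longrightarrow> b' e = inserted_half_edge c' G2 (b e)"
  shows "graph_isomorphism sum_assoc sum_assoc
    (replace_vertex c (replace_vertex b G1 u G2) v G3)
    (replace_vertex b' G1 (Inl u) (replace_vertex c' G2 v G3))"
    (is "graph_isomorphism _ _ ?L ?R")
proof -
  let ?M = "replace_vertex b G1 u G2" and ?N = "replace_vertex c' G2 v G3"
  have "sum_assoc ` verts ?L = verts ?R"
    by (auto simp: image_Un image_image)
  moreover have "sum_assoc ` halves ?L = halves ?R"
    by (auto simp: image_Un image_image internals_replace_vertex)
  moreover have "bd ?R (sum_assoc x) = sum_assoc (bd ?L x)" if x: "x \<in> halves ?L" for x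
  proof (cases x rule: sum_assoc.cases)
    case (1 e)
    then show ?thesis by simp
  next
    \<comment> \<open>An internal half-edge of \<open>G2\<close> is moved onto \<open>G1\<close> if it was attached to \<open>u\<close>.\<close>
    case (2 h)
    then have h: "h \<in> internals G2" using x by (auto simp: internals_replace_vertex)
    show ?thesis
    proof (cases "bd G2 h = u")
      case True
      then obtain e where e: "e \<in> externals G1" "h = b e"
        using gluing_onto_star[OF b internals_in_halves[OF h]] by blast
      then have "Inl h = b' e"
        using bb'[OF e(1)] h by (simp add: inserted_half_edge_def internals_def externals_def)
      then have "bd ?R (Inr (Inl h)) = Inl (bd G1 e)"
        using bd_replace_vertex_gluing[OF b' e(1)] by simp
      then show ?thesis using 2 e by (simp add: bd_replace_vertex_gluing[OF b])
    qed (use 2 in simp)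
  next
    \<comment> \<open>A half-edge of \<open>G3\<close> at \<open>v\<close> is glued to an external half-edge of \<open>G2\<close>, and it ends up on
      \<open>G1\<close> if that half-edge was in turn attached to \<open>u\<close>.\<close>
    case (3 k)
    then have k: "k \<in> halves G3" using x by auto
    show ?thesis
    proof (cases "bd G3 k = v")
      case True
      then obtain h where h: "h \<in> externals G2" "k = c' h" using gluing_onto_star[OF c' k] by blast
      have L: "bd ?L (Inr k) = Inl (bd ?M (Inr h))"
        using bd_replace_vertex_gluing[OF c, of "Inr h"] h cc'[OF h(1)] by simp
      have N: "bd ?N (Inr k) = Inl (bd G2 h)"
        using bd_replace_vertex_gluing[OF c' h(1)] h by simp
      show ?thesis
      proof (cases "bd G2 h = u")
        case True
        then obtain e where e: "e \<in> externals G1" "h = b e"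
          using gluing_onto_star[OF b externals_in_halves[OF h(1)]] by blast
        then have "Inr k = b' e" using bb'[OF e(1)] h by (simp add: inserted_half_edge_def)
        then have "bd ?R (Inr (Inr k)) = Inl (bd G1 e)"
          using bd_replace_vertex_gluing[OF b' e(1)] by simp
        then show ?thesis using 3 L e by (simp add: bd_replace_vertex_gluing[OF b])
      next
        case False
        then show ?thesis using 3 L N by simp
      qed
    next
      case False
      then show ?thesis using 3 by simp
    qed
  qed
  moreover have "sigma ?R (sum_assoc x) = sum_assoc (sigma ?L x)" for x
    by (cases x rule: sum_assoc.cases) simp_all
  moreover have "htype ?R (sum_assoc x) = htype ?L x" for x
    by (cases x rule: sum_assoc.cases) simp_all
  moreover have "vindex ?R (sum_assoc x) = vindex ?L x" for x
    by (cases x rule: sum_assoc.cases) simp_all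
  ultimately show ?thesis
    by (simp add: graph_isomorphism_def bij_betw_def inj_sum_assoc del: replace_vertex_simps)
qed

text \<open>
  The star of a vertex other than the replaced one is unchanged by an insertion, so the two
  gluings can be carried out in either order.
\<close>

lemma graph_isomorphism_insert_commute:
  assumes b: "b \<in> gluings G1 G3 u" and c: "c \<in> gluings G2 G3 v" and uv: "u \<noteq> v"
    and b': "b' \<in> gluings G1 (replace_vertex c G2 v G3) (Inr u)"
    and c': "c' \<in> gluings G2 (replace_vertex b G1 u G3) (Inr v)"
    and bb': "\<And>e. e \<in> externals G1 \<Longrightarrow> b' e = Inr (b e)"
    and cc': "\<And>e. e \<in> externals G2 \<Longrightarrow> c' e = Inr (c e)"
  shows "graph_isomorphism sum_exchange sum_exchange
    (replace_vertex b' G1 (Inr u) (replace_vertex c G2 v G3))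
    (replace_vertex c' G2 (Inr v) (replace_vertex b G1 u G3))"
    (is "graph_isomorphism _ _ ?L ?R")
proof -
  let ?M = "replace_vertex c G2 v G3" and ?N = "replace_vertex b G1 u G3"
  have "sum_exchange ` verts ?L = verts ?R"
  proof -
    have "Inl ` verts G2 \<union> Inr ` (verts G3 - {v}) - {Inr u} = Inl ` verts G2 \<union> Inr ` (verts G3 - {v} - {u})"
      "Inl ` verts G1 \<union> Inr ` (verts G3 - {u}) - {Inr v} = Inl ` verts G1 \<union> Inr ` (verts G3 - {v} - {u})"
      by auto
    then show ?thesis by (auto simp: image_Un image_image)
  qed
  moreover have "sum_exchange ` halves ?L = halves ?R"
    by (auto simp: image_Un image_image)
  moreover have "bd ?R (sum_exchange x) = sum_exchange (bd ?L x)" if x: "x \<in> halves ?L" for x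
  proof (cases x rule: sum_exchange.cases)
    case (3 k)
    then have k: "k \<in> halves G3" using x by auto
    consider "bd G3 k = u" | "bd G3 k = v" | "bd G3 k \<noteq> u" "bd G3 k \<noteq> v" by blast
    then show ?thesis
    proof cases
      case 1
      then obtain e where e: "e \<in> externals G1" "k = b e" using gluing_onto_star[OF b k] by blast
      have "bd ?L (Inr (Inr k)) = Inl (bd G1 e)"
        using bd_replace_vertex_gluing[OF b' e(1)] bb' e by simp
      moreover have "bd ?N (Inr k) = Inl (bd G1 e)"
        using bd_replace_vertex_gluing[OF b e(1)] e by simp
      ultimately show ?thesis using 3 by simp
    next
      case 2
      then obtain e where e: "e \<in> externals G2" "k = c e" using gluing_onto_star[OF c k] by blast
      have "bd ?R (Inr (Inr k)) = Inl (bd G2 e)"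
        using bd_replace_vertex_gluing[OF c' e(1)] cc' e by simp
      moreover have "bd ?M (Inr k) = Inl (bd G2 e)"
        using bd_replace_vertex_gluing[OF c e(1)] e by simp
      ultimately show ?thesis using 3 by simp
    qed (use 3 in simp)
  qed simp_all
  moreover have "sigma ?R (sum_exchange x) = sum_exchange (sigma ?L x)" for x
    by (cases x rule: sum_exchange.cases) simp_all
  moreover have "htype ?R (sum_exchange x) = htype ?L x" for x
    by (cases x rule: sum_exchange.cases) simp_all
  moreover have "vindex ?R (sum_exchange x) = vindex ?L x" for x
    by (cases x rule: sum_exchange.cases) simp_all
  ultimately show ?thesis
    by (simp add: graph_isomorphism_def bij_betw_def inj_sum_exchange del: replace_vertex_simps)
qed

lemma insert_at_nested:
  assumes FY: "feynman_graph (fst Y)" and c: "c \<in> matching_gluings Y Z v"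
  shows "insert_at X (Inl u) (insert_along c Y v Z) =
    (\<Sum>b\<in>matching_gluings X Y u. gen (insert_along
       (\<lambda>e\<in>externals (fst X). inserted_half_edge c (fst Y) (b e)) X (Inl u) (insert_along c Y v Z)))"
proof -
  have cg: "c \<in> gluings (fst Y) (fst Z) v" using matching_gluings_gluings[OF c] .
  have "bij_betw (\<lambda>b. \<lambda>e\<in>externals (fst X). inserted_half_edge c (fst Y) (b e))
    (matching_gluings X Y u) (matching_gluings X (insert_along c Y v Z) (Inl u))"
    by (rule matching_gluings_bij_target)
      (simp_all add: star_replace_vertex_Inl[OF FY cg] htype_inserted_half_edge[OF cg]
        vertex_type_replace_vertex_Inl[OF FY cg])
  from sum.reindex_bij_betw[OF this, symmetric] show ?thesis unfolding insert_at_eq_sum .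
qed

lemma insert_at_apart:
  assumes c: "c \<in> matching_gluings Y Z v" and uv: "u \<noteq> v"
  shows "insert_at X (Inr u) (insert_along c Y v Z) =
    (\<Sum>b\<in>matching_gluings X Z u. gen (insert_along
       (\<lambda>e\<in>externals (fst X). Inr (b e)) X (Inr u) (insert_along c Y v Z)))"
proof -
  have cg: "c \<in> gluings (fst Y) (fst Z) v" using matching_gluings_gluings[OF c] .
  have "bij_betw (\<lambda>b. \<lambda>e\<in>externals (fst X). Inr (b e))
    (matching_gluings X Z u) (matching_gluings X (insert_along c Y v Z) (Inr u))"
    by (rule matching_gluings_bij_target)
      (simp_all add: star_replace_vertex_Inr[OF cg uv] vertex_type_replace_vertex_Inr[OF cg uv])
  from sum.reindex_bij_betw[OF this, symmetric] show ?thesis unfolding insert_at_eq_sum .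
qed

text \<open>
  The gluings of the composite into \<open>Z\<close> are those of \<open>Y\<close> into \<open>Z\<close>. Rewriting the composites by
  \<open>graph_isomorphism_insert_assoc\<close> brings the sum into the form of \<open>insert_at_nested\<close>, where
  the ranges of \<open>b\<close> and \<open>c\<close> do not depend on each other.
\<close>

lemma insert_at_of_composite:
  assumes X: "connected_feynman_graph (fst X)" and Y: "connected_feynman_graph (fst Y)"
    and Z: "connected_feynman_graph (fst Z)" and u: "u \<in> verts (fst Y)"
    and b: "b \<in> matching_gluings X Y u" and v: "v \<in> verts (fst Z)"
  shows "insert_at (insert_along b X u Y) v Z =
    (\<Sum>c\<in>matching_gluings Y Z v. gen (insert_along
       (\<lambda>e\<in>externals (fst X). inserted_half_edge c (fst Y) (b e)) X (Inl u) (insert_along c Y v Z)))"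
proof -
  let ?M = "insert_along b X u Y"
  let ?c' = "\<lambda>c. \<lambda>h\<in>externals (fst ?M). c (projr h)"
  let ?b' = "\<lambda>c. \<lambda>e\<in>externals (fst X). inserted_half_edge c (fst Y) (b e)"
  have F: "feynman_graph (fst X)" "feynman_graph (fst Y)"
    using X Y by (simp_all add: connected_feynman_graph_def)
  have bg: "b \<in> gluings (fst X) (fst Y) u" using matching_gluings_gluings[OF b] .
  have bij: "bij_betw ?c' (matching_gluings Y Z v) (matching_gluings ?M Z v)"
  proof (rule matching_gluings_bij_source)
    show "bij_betw projr (externals (fst ?M)) (externals (fst Y))"
      by (auto simp: bij_betw_def inj_on_def image_image)
    show "residue_type ?M = residue_type Y" by (rule residue_type_insert_along[OF X Y bg u])
  qed auto
  have "gen (insert_along (?c' c) ?M v Z) = gen (insert_along (?b' c) X (Inl u) (insert_along c Y v Z))"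
    if c: "c \<in> matching_gluings Y Z v" for c
  proof (rule gen_insert_along_eqI)
    have cg: "c \<in> gluings (fst Y) (fst Z) v" using matching_gluings_gluings[OF c] .
    show c': "?c' c \<in> gluings (fst ?M) (fst Z) v"
      using matching_gluings_gluings[OF bij_betw_apply[OF bij c]] .
    have "bij_betw (\<lambda>b. \<lambda>e\<in>externals (fst X). inserted_half_edge c (fst Y) (b e))
      (gluings (fst X) (fst Y) u) (gluings (fst X) (fst (insert_along c Y v Z)) (Inl u))"
      by (rule gluings_bij_target)
        (simp_all add: star_replace_vertex_Inl[OF F(2) cg] htype_inserted_half_edge[OF cg])
    then show b': "?b' c \<in> gluings (fst X) (fst (insert_along c Y v Z)) (Inl u)"
      using bg by (rule bij_betw_apply)
    show "connected_feynman_graph (fst ?M)" by (rule connected_insert_along[OF X Y bg u])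
    show "connected_feynman_graph (fst (insert_along c Y v Z))"
      by (rule connected_insert_along[OF Y Z cg v])
    show "graph_isomorphism sum_assoc sum_assoc (replace_vertex (?c' c) (fst ?M) v (fst Z))
        (replace_vertex (?b' c) (fst X) (Inl u) (fst (insert_along c Y v Z)))"
      using graph_isomorphism_insert_assoc[OF bg u c'[unfolded fst_insert_along] cg
          b'[unfolded fst_insert_along]] by simp
    show "snd Z (verts (fst Z)) =
        snd (insert_along c Y v Z) (verts (fst (insert_along c Y v Z)))"
      using index_insert_along[OF Y v] by simp
  qed (use X Z u v in auto)
  then show ?thesis
    unfolding insert_at_eq_sum sum.reindex_bij_betw[OF bij, symmetric] by (rule sum.cong[OF refl])
qed

text \<open>
  The simultaneous insertion of two graphs at distinct vertices of a third one, written as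
  two successive insertions.
\<close>

definition insert_pair ::
  "('u, 'f, 't) indexed_graph \<Rightarrow> ('v, 'h, 't) indexed_graph \<Rightarrow> ('w, 'g, 't) indexed_graph \<Rightarrow>
   ('t graph_class \<Rightarrow>\<^sub>0 'k::field)" where
  "insert_pair X Y Z =
     (\<Sum>v\<in>verts (fst Z). \<Sum>u\<in>verts (fst Z) - {v}.
        \<Sum>c\<in>matching_gluings Y Z v. \<Sum>b\<in>matching_gluings X Z u.
          gen (insert_along (\<lambda>e\<in>externals (fst X). Inr (b e)) X (Inr u) (insert_along c Y v Z)))"

lemma insert_pair_commute:
  fixes X :: "('u, 'f, 't) indexed_graph" and Y :: "('v, 'h, 't) indexed_graph"
    and Z :: "('w, 'g, 't) indexed_graph"
  assumes X: "connected_feynman_graph (fst X)" and Y: "connected_feynman_graph (fst Y)"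
    and Z: "connected_feynman_graph (fst Z)"
  shows "(insert_pair X Y Z :: 't graph_class \<Rightarrow>\<^sub>0 'k::field) = insert_pair Y X Z"
proof -
  let ?V = "verts (fst Z)"
  let ?I = "\<lambda>b u c v. insert_along (\<lambda>e\<in>externals (fst X). Inr (b e)) X (Inr u) (insert_along c Y v Z)"
  let ?J = "\<lambda>c v b u. insert_along (\<lambda>e\<in>externals (fst Y). Inr (c e)) Y (Inr v) (insert_along b X u Z)"
  have fin: "finite ?V" using Z by (simp add: connected_feynman_graph_def feynman_graph_def)
  have eq: "(gen (?I b u c v) :: 't graph_class \<Rightarrow>\<^sub>0 'k) = gen (?J c v b u)"
    if b: "b \<in> matching_gluings X Z u" and c: "c \<in> matching_gluings Y Z v"
      and uv: "u \<in> ?V" "v \<in> ?V" "u \<noteq> v" for b u c v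
  proof (rule gen_insert_along_eqI)
    let ?b' = "\<lambda>e\<in>externals (fst X). Inr (b e)" and ?c' = "\<lambda>e\<in>externals (fst Y). Inr (c e)"
    have bg: "b \<in> gluings (fst X) (fst Z) u" and cg: "c \<in> gluings (fst Y) (fst Z) v"
      using matching_gluings_gluings[OF b] matching_gluings_gluings[OF c] by simp_all
    have "bij_betw (\<lambda>b. \<lambda>e\<in>externals (fst X). Inr (b e)) (gluings (fst X) (fst Z) u)
        (gluings (fst X) (fst (insert_along c Y v Z)) (Inr u))"
      by (rule gluings_bij_target) (simp_all add: star_replace_vertex_Inr[OF cg uv(3)])
    then show b': "?b' \<in> gluings (fst X) (fst (insert_along c Y v Z)) (Inr u)"
      using bg by (rule bij_betw_apply)
    have "bij_betw (\<lambda>c. \<lambda>e\<in>externals (fst Y). Inr (c e)) (gluings (fst Y) (fst Z) v)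
        (gluings (fst Y) (fst (insert_along b X u Z)) (Inr v))"
      by (rule gluings_bij_target) (simp_all add: star_replace_vertex_Inr[OF bg uv(3)[symmetric]])
    then show c': "?c' \<in> gluings (fst Y) (fst (insert_along b X u Z)) (Inr v)"
      using cg by (rule bij_betw_apply)
    show "connected_feynman_graph (fst (insert_along c Y v Z))"
      by (rule connected_insert_along[OF Y Z cg uv(2)])
    show "connected_feynman_graph (fst (insert_along b X u Z))"
      by (rule connected_insert_along[OF X Z bg uv(1)])
    show "graph_isomorphism sum_exchange sum_exchange
        (replace_vertex ?b' (fst X) (Inr u) (fst (insert_along c Y v Z)))
        (replace_vertex ?c' (fst Y) (Inr v) (fst (insert_along b X u Z)))"
      using graph_isomorphism_insert_commute[OF bg cg uv(3) b'[unfolded fst_insert_along]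
          c'[unfolded fst_insert_along]] by simp
    show "snd (insert_along c Y v Z) (verts (fst (insert_along c Y v Z))) =
        snd (insert_along b X u Z) (verts (fst (insert_along b X u Z)))"
      using index_insert_along[OF Y uv(2)] index_insert_along[OF X uv(1)] by simp
  qed (use X Y uv in auto)
  have "(insert_pair X Y Z :: 't graph_class \<Rightarrow>\<^sub>0 'k) = (\<Sum>v\<in>?V. \<Sum>u\<in>?V - {v}.
      \<Sum>c\<in>matching_gluings Y Z v. \<Sum>b\<in>matching_gluings X Z u. gen (?J c v b u))"
    unfolding insert_pair_def
  proof (intro sum.cong refl)
    fix v u c b
    assume "v \<in> ?V" "u \<in> ?V - {v}" "c \<in> matching_gluings Y Z v" "b \<in> matching_gluings X Z u"
    then show "(gen (?I b u c v) :: 't graph_class \<Rightarrow>\<^sub>0 'k) = gen (?J c v b u)" by (intro eq) auto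
  qed
  also have "\<dots> = (\<Sum>v\<in>?V. \<Sum>u | u \<in> ?V \<and> u \<noteq> v.
      \<Sum>b\<in>matching_gluings X Z u. \<Sum>c\<in>matching_gluings Y Z v. gen (?J c v b u))"
    by (intro sum.cong refl sum.swap) auto
  also have "\<dots> = (\<Sum>u\<in>?V. \<Sum>v | v \<in> ?V \<and> u \<noteq> v.
      \<Sum>b\<in>matching_gluings X Z u. \<Sum>c\<in>matching_gluings Y Z v. gen (?J c v b u))"
    by (rule sum.swap_restrict[OF fin fin])
  also have "\<dots> = insert_pair Y X Z"
    unfolding insert_pair_def by (intro sum.cong refl) auto
  finally show ?thesis .
qed

text \<open>
  The vertices of the composite of \<open>Y\<close> and \<open>Z\<close> come either from \<open>Y\<close>, and then inserting \<open>X\<close> there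
  is the same as inserting a composite of \<open>X\<close> and \<open>Y\<close>, or from \<open>Z\<close>, and then \<open>X\<close> and \<open>Y\<close> are
  inserted apart from each other.
\<close>

lemma insert_graph_insert_graph:
  assumes X: "connected_feynman_graph (fst X)" and Y: "connected_feynman_graph (fst Y)"
    and Z: "connected_feynman_graph (fst Z)"
  shows "(\<Sum>v\<in>verts (fst Z). \<Sum>c\<in>matching_gluings Y Z v. insert_graph X (insert_along c Y v Z)) =
    (\<Sum>u\<in>verts (fst Y). \<Sum>b\<in>matching_gluings X Y u. insert_graph (insert_along b X u Y) Z)
    + insert_pair X Y Z"
proof -
  let ?VY = "verts (fst Y)" and ?VZ = "verts (fst Z)"
  let ?K = "\<lambda>u b v c. gen (insert_along (\<lambda>e\<in>externals (fst X). inserted_half_edge c (fst Y) (b e))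
    X (Inl u) (insert_along c Y v Z))"
  have FY: "feynman_graph (fst Y)" using Y by (simp add: connected_feynman_graph_def)
  have fin: "finite ?VY" "finite ?VZ"
    using Y Z by (simp_all add: connected_feynman_graph_def feynman_graph_def)
  have "(\<Sum>v\<in>?VZ. \<Sum>c\<in>matching_gluings Y Z v. insert_graph X (insert_along c Y v Z)) =
    (\<Sum>v\<in>?VZ. \<Sum>c\<in>matching_gluings Y Z v.
      (\<Sum>u\<in>?VY. insert_at X (Inl u) (insert_along c Y v Z)) +
      (\<Sum>u\<in>?VZ - {v}. insert_at X (Inr u) (insert_along c Y v Z)))"
  proof (intro sum.cong refl)
    fix v c
    have "Inl ` ?VY \<inter> Inr ` (?VZ - {v}) = {}" by auto
    then show "insert_graph X (insert_along c Y v Z) =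
      (\<Sum>u\<in>?VY. insert_at X (Inl u) (insert_along c Y v Z)) +
      (\<Sum>u\<in>?VZ - {v}. insert_at X (Inr u) (insert_along c Y v Z))"
      using fin by (simp add: insert_graph_def sum.union_disjoint sum.reindex comp_def)
  qed
  also have "\<dots> =
    (\<Sum>v\<in>?VZ. \<Sum>c\<in>matching_gluings Y Z v. \<Sum>u\<in>?VY. \<Sum>b\<in>matching_gluings X Y u. ?K u b v c) +
    (\<Sum>v\<in>?VZ. \<Sum>c\<in>matching_gluings Y Z v. \<Sum>u\<in>?VZ - {v}.
      insert_at X (Inr u) (insert_along c Y v Z))"
    unfolding sum.distrib
    by (intro arg_cong2[where f = "(+)"] sum.cong refl insert_at_nested[OF FY])
  also have "(\<Sum>v\<in>?VZ. \<Sum>c\<in>matching_gluings Y Z v. \<Sum>u\<in>?VZ - {v}.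
      insert_at X (Inr u) (insert_along c Y v Z)) = insert_pair X Y Z"
    unfolding insert_pair_def
    by (intro sum.cong refl trans[OF sum.swap] insert_at_apart) auto
  also have "(\<Sum>v\<in>?VZ. \<Sum>c\<in>matching_gluings Y Z v. \<Sum>u\<in>?VY. \<Sum>b\<in>matching_gluings X Y u.
      ?K u b v c) =
    (\<Sum>u\<in>?VY. \<Sum>b\<in>matching_gluings X Y u. \<Sum>v\<in>?VZ. \<Sum>c\<in>matching_gluings Y Z v. ?K u b v c)"
    (is "?S = ?S'")
  proof -
    have "?S = (\<Sum>v\<in>?VZ. \<Sum>u\<in>?VY. \<Sum>c\<in>matching_gluings Y Z v. \<Sum>b\<in>matching_gluings X Y u. ?K u b v c)"
      by (rule sum.cong[OF refl], rule sum.swap)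
    also have "\<dots> = (\<Sum>u\<in>?VY. \<Sum>v\<in>?VZ. \<Sum>c\<in>matching_gluings Y Z v. \<Sum>b\<in>matching_gluings X Y u. ?K u b v c)"
      by (rule sum.swap)
    also have "\<dots> = (\<Sum>u\<in>?VY. \<Sum>v\<in>?VZ. \<Sum>b\<in>matching_gluings X Y u. \<Sum>c\<in>matching_gluings Y Z v. ?K u b v c)"
      by (rule sum.cong[OF refl], rule sum.cong[OF refl], rule sum.swap)
    also have "\<dots> = ?S'"
      by (rule sum.cong[OF refl], rule sum.swap)
    finally show ?thesis .
  qed
  also have "\<dots> = (\<Sum>u\<in>?VY. \<Sum>b\<in>matching_gluings X Y u. insert_graph (insert_along b X u Y) Z)"
    unfolding insert_graph_def
    by (intro sum.cong refl insert_at_of_composite[OF X Y Z, symmetric])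
  finally show ?thesis .
qed

section \<open>The bilinear extension\<close>

lemma lookup_scale_space [simp]:
  "Poly_Mapping.lookup (scale_space c x) k = c * Poly_Mapping.lookup x k"
  by (simp add: scale_space_def Poly_Mapping.map.rep_eq when_def)

interpretation scale_space: vector_space "scale_space :: 'k::field \<Rightarrow> ('a \<Rightarrow>\<^sub>0 'k) \<Rightarrow> ('a \<Rightarrow>\<^sub>0 'k)"
  by unfold_locales (auto intro!: poly_mapping_eqI simp: lookup_add algebra_simps)

definition representative_product :: "'t graph_class \<Rightarrow> 't graph_class \<Rightarrow> ('t graph_class \<Rightarrow>\<^sub>0 'k::field)" where
  "representative_product A B = insert_graph (SOME X. X \<in> A) (SOME Y. Y \<in> B)"

text \<open>
  Enlarging the ranges of summation beyond the supports gives two or three products a common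
  range, on which bilinearity holds termwise.
\<close>

lemma insertion_eq_sum:
  assumes "finite K" "Poly_Mapping.keys x \<subseteq> K" "finite L" "Poly_Mapping.keys y \<subseteq> L"
  shows "x \<rhd> y = (\<Sum>A\<in>K. \<Sum>B\<in>L.
    scale_space (Poly_Mapping.lookup x A * Poly_Mapping.lookup y B) (representative_product A B))"
proof -
  have "(\<Sum>B\<in>Poly_Mapping.keys y. scale_space (Poly_Mapping.lookup x A * Poly_Mapping.lookup y B)
      (representative_product A B)) =
    (\<Sum>B\<in>L. scale_space (Poly_Mapping.lookup x A * Poly_Mapping.lookup y B)
      (representative_product A B))" for A
    using assms by (intro sum.mono_neutral_left) (auto simp: in_keys_iff)
  then have "x \<rhd> y = (\<Sum>A\<in>Poly_Mapping.keys x. \<Sum>B\<in>L.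
    scale_space (Poly_Mapping.lookup x A * Poly_Mapping.lookup y B) (representative_product A B))"
    by (simp add: insertion_def representative_product_def)
  also have "\<dots> = (\<Sum>A\<in>K. \<Sum>B\<in>L.
    scale_space (Poly_Mapping.lookup x A * Poly_Mapping.lookup y B) (representative_product A B))"
    using assms by (intro sum.mono_neutral_left) (auto simp: in_keys_iff)
  finally show ?thesis .
qed

lemma insertion_add_left: "(x + y) \<rhd> z = x \<rhd> z + y \<rhd> z"
proof -
  let ?K = "Poly_Mapping.keys x \<union> Poly_Mapping.keys y" and ?L = "Poly_Mapping.keys z"
  have K: "finite ?K" "Poly_Mapping.keys (x + y) \<subseteq> ?K" "Poly_Mapping.keys x \<subseteq> ?K"
    "Poly_Mapping.keys y \<subseteq> ?K" and L: "finite ?L" "?L \<subseteq> ?L"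
    using keys_add[of x y] by auto
  show ?thesis
    unfolding insertion_eq_sum[OF K(1,2) L] insertion_eq_sum[OF K(1,3) L] insertion_eq_sum[OF K(1,4) L]
    by (simp add: lookup_add distrib_right scale_space.scale_left_distrib sum.distrib)
qed

lemma insertion_add_right: "x \<rhd> (y + z) = x \<rhd> y + x \<rhd> z"
proof -
  let ?K = "Poly_Mapping.keys x" and ?L = "Poly_Mapping.keys y \<union> Poly_Mapping.keys z"
  have L: "finite ?L" "Poly_Mapping.keys (y + z) \<subseteq> ?L" "Poly_Mapping.keys y \<subseteq> ?L"
    "Poly_Mapping.keys z \<subseteq> ?L" and K: "finite ?K" "?K \<subseteq> ?K"
    using keys_add[of y z] by auto
  show ?thesis
    unfolding insertion_eq_sum[OF K L(1,2)] insertion_eq_sum[OF K L(1,3)] insertion_eq_sum[OF K L(1,4)]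
    by (simp add: lookup_add distrib_left scale_space.scale_left_distrib sum.distrib)
qed

lemma keys_scale_space: "Poly_Mapping.keys (scale_space c x) \<subseteq> Poly_Mapping.keys x"
  by (auto simp: in_keys_iff)

lemma insertion_scale_left: "scale_space c x \<rhd> y = scale_space c (x \<rhd> y)"
  unfolding insertion_eq_sum[OF finite_keys keys_scale_space finite_keys subset_refl, of c x y]
    insertion_eq_sum[OF finite_keys subset_refl finite_keys subset_refl, of x y]
  by (simp add: scale_space.scale_sum_right mult.assoc)

lemma insertion_scale_right: "x \<rhd> scale_space c y = scale_space c (x \<rhd> y)"
  unfolding insertion_eq_sum[OF finite_keys subset_refl finite_keys keys_scale_space, of x c y]
    insertion_eq_sum[OF finite_keys subset_refl finite_keys subset_refl, of x y]
  by (simp add: scale_space.scale_sum_right mult.left_commute)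

lemma insertion_zero_left: "0 \<rhd> y = 0" and insertion_zero_right: "x \<rhd> 0 = 0"
  by (simp_all add: insertion_def)

lemma insertion_sum_left: "sum f A \<rhd> y = (\<Sum>a\<in>A. f a \<rhd> y)"
  using sum_comp_morphism[where h = "\<lambda>x. x \<rhd> y", OF insertion_zero_left insertion_add_left, of f A]
  by (simp add: comp_def)

lemma insertion_sum_right: "x \<rhd> sum f A = (\<Sum>a\<in>A. x \<rhd> f a)"
  using sum_comp_morphism[where h = "\<lambda>y. x \<rhd> y", OF insertion_zero_right insertion_add_right, of f A]
  by (simp add: comp_def)

text \<open>
  The representatives chosen in the definition of the product are isomorphic to \<open>X\<close> and \<open>Y\<close>. The
  types of \<open>X\<close> and \<open>Y\<close> are arbitrary, so that this also evaluates products with composites.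
\<close>

lemma gen_insertion:
  fixes X :: "('u, 'f, 't) indexed_graph" and Y :: "('v, 'h, 't) indexed_graph"
  assumes X: "connected_feynman_graph (fst X)" and Y: "connected_feynman_graph (fst Y)"
  shows "(gen X :: 't graph_class \<Rightarrow>\<^sub>0 'k::field) \<rhd> gen Y = insert_graph X Y"
proof -
  let ?X = "SOME X'. X' \<in> iso_class X" and ?Y = "SOME Y'. Y' \<in> iso_class Y"
  have F: "feynman_graph (fst X)" "feynman_graph (fst Y)"
    using X Y by (simp_all add: connected_feynman_graph_def)
  have "?X \<in> iso_class X" "?Y \<in> iso_class Y"
    using someI_ex[OF iso_class_nonempty[OF F(1)]] someI_ex[OF iso_class_nonempty[OF F(2)]] .
  then have iso: "isomorphic ?X X" "isomorphic ?Y Y" and f: "feynman_graph (fst ?X)" "feynman_graph (fst ?Y)"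
    by (simp_all add: iso_class_def)
  have c: "connected_feynman_graph (fst ?X)" "connected_feynman_graph (fst ?Y)"
    using isomorphic_connected[OF iso(1) f(1) F(1)] isomorphic_connected[OF iso(2) f(2) F(2)] X Y f
    by (simp_all add: connected_feynman_graph_def)
  have "(gen X :: 't graph_class \<Rightarrow>\<^sub>0 'k) \<rhd> gen Y = insert_graph ?X ?Y"
    by (simp add: insertion_def gen_def)
  also have "\<dots> = insert_graph X ?Y" by (rule insert_graph_isomorphic_left[OF iso(1) c(1) X c(2)])
  also have "\<dots> = insert_graph X Y" by (rule insert_graph_isomorphic_right[OF iso(2) X c(2) Y])
  finally show ?thesis .
qed

section \<open>The space of specified graphs\<close>

lemma graph_isomorphism_cut:
  assumes iso: "graph_isomorphism f g G H" and G: "feynman_graph G" and e: "e \<in> halves G"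
  shows "graph_isomorphism f g (cut G e) (cut H (g e))"
proof -
  have inj: "inj_on g (halves G)" and s: "\<And>h. h \<in> halves G \<Longrightarrow> sigma H (g h) = g (sigma G h)"
    using iso by (auto simp: graph_isomorphism_def bij_betw_def)
  have "g h = g h' \<longleftrightarrow> h = h'" if "h \<in> halves G" "h' \<in> halves G" for h h'
    using inj that by (auto dest: inj_onD)
  then show ?thesis
    using iso s e sigma_in_halves[OF G] by (simp add: graph_isomorphism_def cut_def)
qed

lemma connected_specified_graph_isomorphic:
  assumes X: "connected_specified_graph T X" and iso: "isomorphic X Y" and Y: "feynman_graph (fst Y)"
  shows "connected_specified_graph T Y"
proof -
  have G: "graph_of_theory T (fst X)" "one_PI (fst X)" "residue_type X \<in> vertex_types T"
    and cX: "connected_feynman_graph (fst X)" and FX: "feynman_graph (fst X)"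
    using X connected_specified_graph_connected[OF X]
    by (auto simp: connected_specified_graph_iff graph_of_theory_def)
  obtain f g where fg: "graph_isomorphism f g (fst X) (fst Y)"
    using iso by (auto simp: isomorphic_connected_iff[OF cX])
  have cY: "connected_feynman_graph (fst Y)"
    using isomorphic_connected[OF iso FX Y] cX Y by (simp add: connected_feynman_graph_def)
  have V: "f ` verts (fst X) = verts (fst Y)" and E: "g ` halves (fst X) = halves (fst Y)"
    using fg by (auto simp: graph_isomorphism_def bij_betw_def)
  have "htype (fst Y) h \<in> half_edge_types T" if h: "h \<in> halves (fst Y)" for h
  proof -
    from h[folded E] obtain e where "h = g e" "e \<in> halves (fst X)" by (rule imageE)
    then show ?thesis using fg G(1) by (simp add: graph_isomorphism_def graph_of_theory_def)
  qed
  moreover have "vertex_type (fst Y) w \<in> vertex_types T" if w: "w \<in> verts (fst Y)" for w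
  proof -
    from w[folded V] obtain v where "w = f v" "v \<in> verts (fst X)" by (rule imageE)
    then show ?thesis
      using graph_isomorphism_vertex_type[OF fg FX] G(1) by (simp add: graph_of_theory_def)
  qed
  moreover have "connected_graph (cut (fst Y) h)" if h: "h \<in> internals (fst Y)" for h
  proof -
    have "h \<in> g ` internals (fst X)"
      using h graph_isomorphism_bij_internals[OF fg FX] by (simp add: bij_betw_def)
    then obtain e where e: "h = g e" "e \<in> internals (fst X)" by (rule imageE)
    then have e': "e \<in> halves (fst X)" "g e \<in> halves (fst Y)"
      using h by (simp_all add: internals_def)
    have "connected_graph (cut (fst X) e)" using e G(2) by (simp add: one_PI_def)
    then show ?thesis
      unfolding e(1)
      using graph_isomorphism_connected[OF graph_isomorphism_cut[OF fg FX e'(1)]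
          feynman_graph_cut[OF FX e'(1)] _ feynman_graph_cut[OF Y e'(2)]] by simp
  qed
  ultimately show ?thesis
    using G(3) residue_type_isomorphic[OF iso cX cY] cY
    by (simp add: connected_specified_graph_iff graph_of_theory_def one_PI_def
        connected_feynman_graph_def)
qed

lemma gen_in_graph_space:
  fixes X :: "('v, 'h, 't) indexed_graph"
  assumes X: "connected_specified_graph T X"
  shows "(gen X :: 't graph_class \<Rightarrow>\<^sub>0 'k::field) \<in> graph_space T"
proof -
  have cX: "connected_feynman_graph (fst X)" using connected_specified_graph_connected[OF X] .
  then have F: "feynman_graph (fst X)" by (simp add: connected_feynman_graph_def)
  obtain Y where "Y \<in> iso_class X" using iso_class_nonempty[OF F] by blast
  then have Y: "isomorphic Y X" "feynman_graph (fst Y)" by (simp_all add: iso_class_def)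
  then have cY: "connected_feynman_graph (fst Y)"
    using isomorphic_connected[OF Y F] cX by (simp add: connected_feynman_graph_def)
  have "connected_specified_graph T Y"
    using connected_specified_graph_isomorphic[OF X isomorphic_sym[OF Y(1) cY cX] Y(2)] .
  moreover have "iso_class X = iso_class Y" using iso_class_eqI[OF Y(1) cY cX] by simp
  ultimately have "iso_class X \<in> generators T" unfolding generators_def by blast
  then show ?thesis by (simp add: graph_space_def gen_def)
qed

lemma subspace_graph_space:
  "scale_space.subspace (graph_space T :: ('t graph_class \<Rightarrow>\<^sub>0 'k::field) set)"
proof (rule scale_space.subspaceI)
  show "x + y \<in> graph_space T" if "x \<in> graph_space T" "y \<in> graph_space T"
    for x y :: "'t graph_class \<Rightarrow>\<^sub>0 'k"
    using that keys_add[of x y] by (auto simp: graph_space_def)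
  show "scale_space c x \<in> graph_space T" if "x \<in> graph_space T" for c and x :: "'t graph_class \<Rightarrow>\<^sub>0 'k"
    using that keys_scale_space[of c x] by (auto simp: graph_space_def)
qed (simp add: graph_space_def)

text \<open>
  The generators span: a linear condition on the space has to be checked on generators only.
\<close>

lemma graph_space_subset_subspace:
  fixes S :: "('t graph_class \<Rightarrow>\<^sub>0 'k::field) set"
  assumes S: "scale_space.subspace S"
    and gen: "\<And>X :: (nat, nat, 't) indexed_graph. connected_specified_graph T X \<Longrightarrow> gen X \<in> S"
    and x: "x \<in> graph_space T"
  shows "x \<in> S"
proof -
  have "x = (\<Sum>A\<in>Poly_Mapping.keys x. scale_space (Poly_Mapping.lookup x A) (Poly_Mapping.single A 1))"
  proof (rule poly_mapping_eqI)
    fix k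
    have "(\<Sum>A\<in>Poly_Mapping.keys x. Poly_Mapping.lookup x A * (1 when A = k)) =
        (\<Sum>A\<in>Poly_Mapping.keys x. if A = k then Poly_Mapping.lookup x k else 0)"
      by (intro sum.cong) (auto simp: when_def)
    then show "Poly_Mapping.lookup x k = Poly_Mapping.lookup (\<Sum>A\<in>Poly_Mapping.keys x.
        scale_space (Poly_Mapping.lookup x A) (Poly_Mapping.single A 1)) k"
      by (simp add: lookup_sum lookup_single in_keys_iff)
  qed
  also have "\<dots> \<in> S"
  proof (intro scale_space.subspace_sum[OF S] scale_space.subspace_scale[OF S])
    fix A assume "A \<in> Poly_Mapping.keys x"
    then have "A \<in> generators T" using x by (auto simp: graph_space_def)
    then show "Poly_Mapping.single A 1 \<in> S" using gen by (auto simp: generators_def gen_def)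
  qed
  finally show ?thesis .
qed

lemma insert_graph_in_graph_space:
  assumes X: "connected_specified_graph T X" and Y: "connected_specified_graph T Y"
  shows "insert_graph X Y \<in> graph_space T"
  unfolding insert_graph_def insert_at_eq_sum
  by (intro scale_space.subspace_sum[OF subspace_graph_space] gen_in_graph_space
      connected_specified_insert_along[OF X Y] matching_gluings_gluings)

lemma insertion_in_graph_space:
  fixes x y :: "'t graph_class \<Rightarrow>\<^sub>0 'k::field"
  assumes x: "x \<in> graph_space T" and y: "y \<in> graph_space T"
  shows "x \<rhd> y \<in> graph_space T"
proof -
  let ?V = "graph_space T :: ('t graph_class \<Rightarrow>\<^sub>0 'k) set"
  have V: "scale_space.subspace ?V" by (rule subspace_graph_space)
  note V = scale_space.subspace_0[OF V] scale_space.subspace_add[OF V] scale_space.subspace_scale[OF V]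
  have gen: "(gen X :: 't graph_class \<Rightarrow>\<^sub>0 'k) \<rhd> gen Y \<in> graph_space T"
    if "connected_specified_graph T X" "connected_specified_graph T Y"
    for X Y :: "(nat, nat, 't) indexed_graph"
    using that by (simp add: gen_insertion connected_specified_graph_connected
        insert_graph_in_graph_space)
  have "y \<in> {y. gen X \<rhd> y \<in> graph_space T}" if X: "connected_specified_graph T X"
    for X :: "(nat, nat, 't) indexed_graph"
  proof (rule graph_space_subset_subspace[OF _ _ y])
    show "scale_space.subspace {y. gen X \<rhd> y \<in> ?V}"
      by (intro scale_space.subspaceI)
        (simp_all add: insertion_zero_right insertion_add_right insertion_scale_right V)
  qed (use gen X in auto)
  then have "x \<in> {x. x \<rhd> y \<in> graph_space T}"
  proof (intro graph_space_subset_subspace[OF _ _ x])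
    show "scale_space.subspace {x. x \<rhd> y \<in> graph_space T}"
      by (intro scale_space.subspaceI)
        (simp_all add: insertion_zero_left insertion_add_left insertion_scale_left V)
  qed auto
  then show ?thesis by simp
qed

section \<open>The associator\<close>

definition insertion_associator ::
  "('t graph_class \<Rightarrow>\<^sub>0 'k::field) \<Rightarrow> ('t graph_class \<Rightarrow>\<^sub>0 'k) \<Rightarrow> ('t graph_class \<Rightarrow>\<^sub>0 'k) \<Rightarrow>
   ('t graph_class \<Rightarrow>\<^sub>0 'k)" where
  "insertion_associator x y z = (x \<rhd> y) \<rhd> z - x \<rhd> (y \<rhd> z)"

lemma insertion_associator_gen:
  fixes X Y Z :: "(nat, nat, 't) indexed_graph"
  assumes X: "connected_feynman_graph (fst X)" and Y: "connected_feynman_graph (fst Y)"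
    and Z: "connected_feynman_graph (fst Z)"
  shows "insertion_associator (gen X) (gen Y) (gen Z) = - (insert_pair X Y Z :: 't graph_class \<Rightarrow>\<^sub>0 'k::field)"
proof -
  have "(gen X \<rhd> gen Y) \<rhd> gen Z = (\<Sum>u\<in>verts (fst Y). \<Sum>b\<in>matching_gluings X Y u.
      gen (insert_along b X u Y) \<rhd> (gen Z :: 't graph_class \<Rightarrow>\<^sub>0 'k))"
    unfolding gen_insertion[OF X Y] insert_graph_def insert_at_eq_sum insertion_sum_left ..
  also have "\<dots> = (\<Sum>u\<in>verts (fst Y). \<Sum>b\<in>matching_gluings X Y u. insert_graph (insert_along b X u Y) Z)"
    by (intro sum.cong refl gen_insertion connected_insert_along X Y Z matching_gluings_gluings)
  finally have left: "(gen X \<rhd> gen Y) \<rhd> gen Z =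
    (\<Sum>u\<in>verts (fst Y). \<Sum>b\<in>matching_gluings X Y u.
      insert_graph (insert_along b X u Y) Z :: 't graph_class \<Rightarrow>\<^sub>0 'k)" .
  have "gen X \<rhd> (gen Y \<rhd> gen Z) = (\<Sum>v\<in>verts (fst Z). \<Sum>c\<in>matching_gluings Y Z v.
      (gen X :: 't graph_class \<Rightarrow>\<^sub>0 'k) \<rhd> gen (insert_along c Y v Z))"
    unfolding gen_insertion[OF Y Z] insert_graph_def insert_at_eq_sum insertion_sum_right ..
  also have "\<dots> = (\<Sum>v\<in>verts (fst Z). \<Sum>c\<in>matching_gluings Y Z v. insert_graph X (insert_along c Y v Z))"
    by (intro sum.cong refl gen_insertion connected_insert_along X Y Z matching_gluings_gluings)
  also have "\<dots> = (gen X \<rhd> gen Y) \<rhd> gen Z + insert_pair X Y Z"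
    unfolding left by (rule insert_graph_insert_graph[OF X Y Z])
  finally show ?thesis by (simp add: insertion_associator_def)
qed

text \<open>
  The identity is linear in each argument, so it passes from generators to the space one
  argument at a time.
\<close>

lemma insertion_associator_commute:
  fixes x y z :: "'t graph_class \<Rightarrow>\<^sub>0 'k::field"
  assumes x: "x \<in> graph_space T" and y: "y \<in> graph_space T" and z: "z \<in> graph_space T"
  shows "insertion_associator x y z = insertion_associator y x z"
proof -
  let ?A = "insertion_associator :: ('t graph_class \<Rightarrow>\<^sub>0 'k) \<Rightarrow> _"
  have linear: "?A 0 y z = 0" "?A x 0 z = 0" "?A x y 0 = 0"
    "?A (x + x') y z = ?A x y z + ?A x' y z" "?A x (y + y') z = ?A x y z + ?A x y' z"
    "?A x y (z + z') = ?A x y z + ?A x y z'" "?A (scale_space c x) y z = scale_space c (?A x y z)"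
    "?A x (scale_space c y) z = scale_space c (?A x y z)"
    "?A x y (scale_space c z) = scale_space c (?A x y z)" for x x' y y' z z' c
    by (simp_all add: insertion_associator_def insertion_add_left insertion_add_right
        insertion_scale_left insertion_scale_right insertion_zero_left insertion_zero_right
        scale_space.scale_right_diff_distrib)
  have lin: "scale_space.subspace {x. ?A x y z = ?A y x z}" "scale_space.subspace {y. ?A x y z = ?A y x z}"
    "scale_space.subspace {z. ?A x y z = ?A y x z}" for x y z
    by (intro scale_space.subspaceI; simp add: linear)+
  have gen: "?A (gen X) (gen Y) (gen Z) = ?A (gen Y) (gen X) (gen Z)"
    if "connected_specified_graph T X" "connected_specified_graph T Y" "connected_specified_graph T Z"
    for X Y Z :: "(nat, nat, 't) indexed_graph"
    using that[THEN connected_specified_graph_connected]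
    by (simp add: insertion_associator_gen insert_pair_commute[of X Y Z])
  have "z \<in> {z. ?A (gen X) (gen Y) z = ?A (gen Y) (gen X) z}"
    if "connected_specified_graph T X" "connected_specified_graph T Y"
    for X Y :: "(nat, nat, 't) indexed_graph"
    by (rule graph_space_subset_subspace[OF lin(3) _ z]) (use gen that in auto)
  then have "y \<in> {y. ?A (gen X) y z = ?A y (gen X) z}" if "connected_specified_graph T X"
    for X :: "(nat, nat, 't) indexed_graph"
    by (intro graph_space_subset_subspace[OF lin(2) _ y]) (use that in auto)
  then have "x \<in> {x. ?A x y z = ?A y x z}"
    by (intro graph_space_subset_subspace[OF lin(1) _ x]) auto
  then show ?thesis by simp
qed

theorem theorem2:
  fixes T :: "'t theory_types"
  assumes "physical_theory T"
  shows "(\<forall>(X :: (nat, nat, 't) indexed_graph) (Y :: (nat, nat, 't) indexed_graph).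
            connected_specified_graph T X \<longrightarrow> connected_specified_graph T Y \<longrightarrow>
            (gen X :: 't graph_class \<Rightarrow>\<^sub>0 'k::field) \<rhd> gen Y = insert_graph X Y) \<and>
         left_pre_lie_algebra
           (scale_space :: 'k \<Rightarrow> ('t graph_class \<Rightarrow>\<^sub>0 'k) \<Rightarrow> ('t graph_class \<Rightarrow>\<^sub>0 'k))
           (graph_space T) (\<rhd>)"
proof (intro conjI allI impI)
  show "(gen X :: 't graph_class \<Rightarrow>\<^sub>0 'k) \<rhd> gen Y = insert_graph X Y"
    if "connected_specified_graph T X" "connected_specified_graph T Y"
    for X Y :: "(nat, nat, 't) indexed_graph"
    using that by (intro gen_insertion connected_specified_graph_connected)
  show "left_pre_lie_algebra
      (scale_space :: 'k \<Rightarrow> ('t graph_class \<Rightarrow>\<^sub>0 'k) \<Rightarrow> ('t graph_class \<Rightarrow>\<^sub>0 'k)) (graph_space T) (\<rhd>)"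
  proof
    show "(x \<rhd> y) \<rhd> z - x \<rhd> (y \<rhd> z) = (y \<rhd> x) \<rhd> z - y \<rhd> (x \<rhd> z)"
      if "x \<in> graph_space T" "y \<in> graph_space T" "z \<in> graph_space T"
      for x y z :: "'t graph_class \<Rightarrow>\<^sub>0 'k"
      using insertion_associator_commute[OF that] by (simp add: insertion_associator_def)
  qed (simp_all add: subspace_graph_space insertion_in_graph_space insertion_add_left
      insertion_add_right insertion_scale_left insertion_scale_right)
qed

end
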